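(* Let $\mathfrak{g}$ be of type $C_3$ and let $m_+ = Y_{1,q^{4}}\,Y_{2,q}\,Y_{3,q^{-2}}$. Then the Frenkel-Mukhin (FM) algorithm for $\mathfrak g$ started from the dominant monomial $m_+$ fails; that is, at some stage of the algorithm, when the expansions at some weight $\lambda$ are about to be performed, the current colored polynomial $\chi$ contains a monomial of weight $\lambda$ that is not admissible, so that the algorithm halts halfway.
   Context: Setting. $\mathfrak g$ is of type $C_3$, $I=\{1,2,3\}$, with $\alpha_3$ the long simple root; $q\in\mathbb C^\times$ is not a root of unity; $q_1=q_2=q$, $q_3=q^2$. $\omega_1,\omega_2,\omega_3$ are the fundamental weights, $P=\bigoplus_{i\in I}\mathbb Z\omega_i$, and $\alpha_1=2\omega_1-\omega_2$, $\alpha_2=-\omega_1+2\omega_2-\omega_3$, $\alpha_3=-2\omega_2+2\omega_3$. Work in the Laurent polynomial ring $\mathbb Z[Y_{i,a}^{\pm1}]_{i\in I;\,a\in\mathbb C^\times}$ and set $A_{1,a}=Y_{1,aq^{-1}}Y_{1,aq}Y_{2,a}^{-1}$, $A_{2,a}=Y_{2,aq^{-1}}Y_{2,aq}Y_{1,a}^{-1}Y_{3,a}^{-1}$, $A_{3,a}=Y_{3,aq^{-2}}Y_{3,aq^{2}}Y_{2,aq^{-1}}^{-1}Y_{2,aq}^{-1}$. Weights. The weight of a monomial $\prod_{i}\bigl(\prod_{r=1}^{k_i}Y_{i,a_{ir}}\prod_{s=1}^{l_i}Y_{i,b_{is}}^{-1}\bigr)$ is $\sum_i(k_i-l_i)\omega_i\in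 P$. The natural partial order on $P$: $\lambda\ge\lambda'$ iff $\lambda-\lambda'\in\sum_i\mathbb Z_{\ge0}\alpha_i$. Dominance. A monomial is $i$-dominant if it contains no $Y_{i,a}^{-1}$ ($a\in\mathbb C^\times$), and dominant if it is $i$-dominant for all $i\in I$. Colorings. A coloring of a monomial $m$ occurring in a polynomial $\chi$ with coefficient $s$ ($\in\mathbb Z_{\ge 0}$) is a set of integers $\{s_i\}_{i\in I}$ with $0\le s_i\le s$. A polynomial is colored if all monomials occurring in it have colorings. A monomial $m$ occurring in a colored polynomial $\chi$ with coefficient $s$ and coloring $\{s_i\}$ is admissible if, for every $i\in I$ with $s_i<s$, $m$ is $i$-dominant. The polynomial $\mu$. Let $m$ be $i$-dominant. Let $\overline m$ be the image of $m$ under $Y_{i,a}^{\pm1}\mapsto Y_a^{\pm1}$, $Y_{j,a}^{\pm1}\mapsto1$ ($j\ne i$). A $q_i$-string is a set $\Sigma_{a,r}=\{aq_i^{\,r-2k+1}\}_{k=1,\dots,r}$. Two $q_i$-strings are in general position if their union is not a $q_i$-string or one contains the other. There is a factorization, unique up to permutation, $\overline m=\prod_{p=1}^{k}\prod_{b\in\Sigma_{a_p,r_p}}Y_b$ with the $\Sigma_{a_p,r_p}$ pairwise in general position. Put $$\mu=m\prod_{p=1}^{k}\Bigl(\sum_{l=0}^{r_p}\prod_{j=1}^{l}A^{-1}_{i,\,a_pq_i^{\,r_p-2j+2}}\Bigr).$$ (This is the lift to $\mathfrak g$ of the $q$-character of the irreducible $U_{q_i}(\widehat{\mathfrak{sl}}_2)$-module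 with highest weight monomial $\overline m$.) $i$-expansion. Let $m$ be an admissible monomial of a colored polynomial $\chi$ with coefficient $s$ and coloring $\{s_j\}$. The $i$-expansion $i_m(\chi)$ is defined as follows. If $s_i=s$, then $i_m(\chi)=\chi$. If $s_i<s$ (so that $m$ is $i$-dominant, by admissibility), take $\mu=m\prod_{p=1}^{k}\bigl(\sum_{l=0}^{r_p}\prod_{j=1}^{l}A^{-1}_{i,\,a_pq_i^{\,r_p-2j+2}}\bigr)$, where $\overline m=\prod_{p=1}^{k}\prod_{b\in\Sigma_{a_p,r_p}}Y_b$ is the factorization, with $q_i$-strings $\Sigma_{a_p,r_p}$ pairwise in general position, of the image $\overline m$ of $m$ under $Y_{i,a}^{\pm1}\mapsto Y_a^{\pm1}$, $Y_{j,a}^{\pm1}\mapsto1$ ($j\ne i$), and, for each monomial $n$ occurring in $\mu$, with coefficient $t$: if $n$ does not occur in $\chi$, add $n$ with coefficient $t(s-s_i)$ and coloring $s'_i=t(s-s_i)$, $s'_j=0$ for $j\ne i$; if $n$ occurs in $\chi$ with coefficient $r$ and coloring $\{r_j\}$, then in $i_m(\chi)$ its coefficient is $\max\{r,\,r_i+t(s-s_i)\}$ and its coloring is $s'_i=r_i+t(s-s_i)$, $s'_j=r_j$ for $j\ne i$. All other monomials keep their coefficients and colorings. The FM algorithm for a dominant monomial $m_+$ of weight $\lambda_+$. Choose any total order on $\{\mu\in P\mid\mu\le\lambda_+\}$ compatible with the natural partial order, and enumerate this set as $\lambda_1=\lambda_+>\lambda_2>\lambda_3>\cdots$. Step 1: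 set $\chi=m_+$ with all colorings of $m_+$ equal to $0$. Step 2: for $\lambda=\lambda_1,\lambda_2,\dots$ repeat (i)-(iii): (i) Let $m_1,\dots,m_t$ be all monomials occurring in the current $\chi$ of weight $\lambda$. If at least one of them is non-admissible, the algorithm halts halfway, and one says the algorithm fails (at any such non-admissible monomial). (ii) For all $i\in I$ and all $k\in\{1,\dots,t\}$, replace $\chi$ by the $i$-expansion $i_{m_k}(\chi)$. (iii) If no monomial occurring in $\chi$ has weight less than $\lambda$ in the chosen total order, the algorithm stops (completes) with output $\chi$. *)

theory Defs
  imports
    Complex_Main
    "HOL-Library.Multiset"
    "HOL-Library.Poly_Mapping"
    "HOL-Analysis.Finite_Cartesian_Product"
begin

section \<open>Type \<open>C\<^sub>3\<close>: nodes, weights, monomials\<close>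

text \<open>The node \<open>N3\<close> carries the long simple root.\<close>

datatype node = N1 | N2 | N3

lemma UNIV_node: "UNIV = {N1, N2, N3}"
  using node.exhaust by auto

instance node :: finite
  by standard (simp add: UNIV_node)

type_synonym weight = "int ^ node"

definition \<omega> :: "node \<Rightarrow> weight" where
  "\<omega> i = axis i 1"

fun \<alpha> :: "node \<Rightarrow> weight" where
  "\<alpha> N1 = 2 *s \<omega> N1 - \<omega> N2"
| "\<alpha> N2 = - \<omega> N1 + 2 *s \<omega> N2 - \<omega> N3"
| "\<alpha> N3 = - (2 *s \<omega> N2) + 2 *s \<omega> N3"

text \<open>
  The natural partial order on weights (not the componentwise order that vectors carry by
  default).
\<close>

definition weight_le :: "weight \<Rightarrow> weight \<Rightarrow> bool" where
  "weight_le \<nu> \<kappa> \<longleftrightarrow> (\<exists>c :: node \<Rightarrow> nat. \<kappa> - \<nu> = (\<Sum>i\<in>UNIV. int (c i) *s \<alpha> i))"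

text \<open>
  A monomial in the \<open>Y\<^bsub>i,a\<^esub>\<close> and their inverses is represented by its exponent vector, so
  multiplication of monomials is addition of exponent vectors; the Laurent polynomial ring is
  then the group ring of the group of monomials, with the convolution product of
  \<^type>\<open>poly_mapping\<close>.  Spectral parameters are nonzero: starting from monomials with nonzero
  parameters, and for nonzero \<open>q\<close>, no other monomials are ever produced below.
\<close>

type_synonym monomial = "(node \<times> complex) \<Rightarrow>\<^sub>0 int"

type_synonym laurent = "monomial \<Rightarrow>\<^sub>0 int"

definition Y :: "node \<Rightarrow> complex \<Rightarrow> monomial" where
  "Y i a = Poly_Mapping.single (i, a) 1"

fun A :: "complex \<Rightarrow> node \<Rightarrow> complex \<Rightarrow> monomial" where
  "A q N1 a = Y N1 (a / q) + Y N1 (a * q) - Y N2 a"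
| "A q N2 a = Y N2 (a / q) + Y N2 (a * q) - Y N1 a - Y N3 a"
| "A q N3 a = Y N3 (a / q ^ 2) + Y N3 (a * q ^ 2) - Y N2 (a / q) - Y N2 (a * q)"

fun q_node :: "complex \<Rightarrow> node \<Rightarrow> complex" where
  "q_node q N1 = q"
| "q_node q N2 = q"
| "q_node q N3 = q ^ 2"

definition monomial_weight :: "monomial \<Rightarrow> weight" where
  "monomial_weight m = (\<Sum>(i, a)\<in>Poly_Mapping.keys m. Poly_Mapping.lookup m (i, a) *s \<omega> i)"

definition i_dominant :: "node \<Rightarrow> monomial \<Rightarrow> bool" where
  "i_dominant i m \<longleftrightarrow> (\<forall>a. 0 \<le> Poly_Mapping.lookup m (i, a))"


section \<open>Strings and the polynomial \<open>\<mu>\<close>\<close>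

definition qstring :: "complex \<Rightarrow> complex \<Rightarrow> nat \<Rightarrow> complex set" where
  "qstring p a r = (\<lambda>k. a * p powi (int r - 2 * int k + 1)) ` {1..r}"

definition is_qstring :: "complex \<Rightarrow> complex set \<Rightarrow> bool" where
  "is_qstring p S \<longleftrightarrow> (\<exists>a r. a \<noteq> 0 \<and> 1 \<le> r \<and> S = qstring p a r)"

definition general_position :: "complex \<Rightarrow> complex set \<Rightarrow> complex set \<Rightarrow> bool" where
  "general_position p S T \<longleftrightarrow> \<not> is_qstring p (S \<union> T) \<or> S \<subseteq> T \<or> T \<subseteq> S"

text \<open>
  The image of \<open>m\<close> under \<open>Y\<^bsub>i,a\<^esub> \<mapsto> Y\<^bsub>a\<^esub>\<close> and \<open>Y\<^bsub>j,a\<^esub> \<mapsto> 1\<close> for \<open>j \<noteq> i\<close>, again as an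
  exponent vector.
\<close>

definition bar :: "node \<Rightarrow> monomial \<Rightarrow> (complex \<Rightarrow>\<^sub>0 int)" where
  "bar i m = Poly_Mapping.map_key (Pair i) m"

text \<open>
  A factorization is the multiset of the pairs \<open>(a\<^sub>p, r\<^sub>p)\<close>.  Empty strings are excluded, since
  otherwise it would not be unique.  A string is trivially in general position with itself, so
  repeated strings need no separate treatment.
\<close>

definition string_factorization :: "complex \<Rightarrow> node \<Rightarrow> monomial \<Rightarrow> (complex \<times> nat) multiset \<Rightarrow> bool"
  where
  "string_factorization q i m M \<longleftrightarrow>
     (\<forall>(a, r)\<in>#M. a \<noteq> 0 \<and> 1 \<le> r) \<and>
     (\<forall>(a, r)\<in>#M. \<forall>(b, s)\<in>#M.
        general_position (q_node q i) (qstring (q_node q i) a r) (qstring (q_node q i) b s)) \<and>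
     bar i m = (\<Sum>(a, r)\<in>#M. \<Sum>b\<in>qstring (q_node q i) a r. Poly_Mapping.single b 1)"

definition mu :: "complex \<Rightarrow> node \<Rightarrow> monomial \<Rightarrow> laurent" where
  "mu q i m =
     Poly_Mapping.single m 1 *
     (\<Prod>(a, r)\<in>#(THE M. string_factorization q i m M).
        \<Sum>l = 0..r. Poly_Mapping.single
          (- (\<Sum>j = 1..l. A q i (a * q_node q i powi (int r - 2 * int j + 2)))) 1)"


section \<open>Colored polynomials and expansions\<close>

text \<open>
  \<open>col X m i\<close> is the color \<open>s\<^sub>i\<close> of the monomial \<open>m\<close>.  It is meaningful only for monomials
  occurring in \<open>pol X\<close>; its values elsewhere are never used.
\<close>

record colored =
  pol :: laurent
  col :: "monomial \<Rightarrow> node \<Rightarrow> int"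

text \<open>
  The bounds \<open>0 \<le> s\<^sub>i \<le> s\<close> on the colors.  They hold initially and are preserved by
  expansions (\<open>is_colored_FM_start\<close> and \<open>is_colored_expand\<close> below), so that every colored
  polynomial arising in the algorithm satisfies them.
\<close>

definition is_colored :: "colored \<Rightarrow> bool" where
  "is_colored X \<longleftrightarrow> (\<forall>m\<in>Poly_Mapping.keys (pol X). \<forall>i.
     0 \<le> col X m i \<and> col X m i \<le> Poly_Mapping.lookup (pol X) m)"

definition admissible :: "colored \<Rightarrow> monomial \<Rightarrow> bool" where
  "admissible X m \<longleftrightarrow>
     (\<forall>i. col X m i < Poly_Mapping.lookup (pol X) m \<longrightarrow> i_dominant i m)"

text \<open>
  Coefficients after an expansion: \<open>f\<close> is the current polynomial, \<open>g\<close> is \<open>\<mu>\<close>, \<open>c n\<close> is the current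
  \<open>i\<close>-th color of \<open>n\<close>, and \<open>d\<close> is the number \<open>s - s\<^sub>i\<close>.
\<close>

lift_definition expand_pol ::
  "('a \<Rightarrow>\<^sub>0 int) \<Rightarrow> ('a \<Rightarrow>\<^sub>0 int) \<Rightarrow> ('a \<Rightarrow> int) \<Rightarrow> int \<Rightarrow> ('a \<Rightarrow>\<^sub>0 int)" is
  "\<lambda>f g c d n.
     if g n = 0 then f n
     else if f n = 0 then g n * d
     else max (f n) (c n + g n * d)"
proof -
  fix f g :: "'a \<Rightarrow> int" and c :: "'a \<Rightarrow> int" and d :: int
  assume "finite {n. f n \<noteq> 0}" and "finite {n. g n \<noteq> 0}"
  then have "finite ({n. f n \<noteq> 0} \<union> {n. g n \<noteq> 0})"
    by simp
  then show "finite {n. (if g n = 0 then f n else if f n = 0 then g n * d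
      else max (f n) (c n + g n * d)) \<noteq> 0}"
    by (rule rev_finite_subset) auto
qed

definition expand :: "complex \<Rightarrow> node \<Rightarrow> monomial \<Rightarrow> colored \<Rightarrow> colored" where
  "expand q i m X =
    (let s = Poly_Mapping.lookup (pol X) m; s\<^sub>i = col X m i; \<mu> = mu q i m in
     if s\<^sub>i = s then X
     else
       \<lparr>pol = expand_pol (pol X) \<mu> (\<lambda>n. col X n i) (s - s\<^sub>i),
        col = (\<lambda>n j.
          if n \<notin> Poly_Mapping.keys \<mu> then col X n j
          else if n \<notin> Poly_Mapping.keys (pol X) then
            (if j = i then Poly_Mapping.lookup \<mu> n * (s - s\<^sub>i) else 0)
          else
            (if j = i then col X n i + Poly_Mapping.lookup \<mu> n * (s - s\<^sub>i) else col X n j))\<rparr>)"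

lemma mu_nonneg: "0 \<le> Poly_Mapping.lookup (mu q i m) n"
proof -
  have mult: "\<forall>n. 0 \<le> Poly_Mapping.lookup (f * g) n"
    if "\<forall>n. 0 \<le> Poly_Mapping.lookup f n" "\<forall>n. 0 \<le> Poly_Mapping.lookup g n" for f g :: laurent
    using that unfolding lookup_mult Sum_any.expand_set
    by (auto intro!: sum_nonneg mult_nonneg_nonneg simp: when_def)
  have prod: "\<forall>n. 0 \<le> Poly_Mapping.lookup (\<Prod>x\<in>#M. F x) n"
    if "\<And>x n. 0 \<le> Poly_Mapping.lookup (F x) n" for M and F :: "complex \<times> nat \<Rightarrow> laurent"
    by (induction M) (auto simp: lookup_one when_def intro!: mult[rule_format] that)
  have "\<forall>n. 0 \<le> Poly_Mapping.lookup (mu q i m) n"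
    unfolding mu_def
    by (rule mult, simp add: lookup_single when_def, rule prod)
      (auto simp: lookup_sum lookup_single when_def intro!: sum_nonneg)
  then show ?thesis ..
qed

lemma is_colored_expand:
  assumes "is_colored X" and "m \<in> Poly_Mapping.keys (pol X)"
  shows "is_colored (expand q i m X)"
proof -
  have d: "0 \<le> Poly_Mapping.lookup (pol X) m - col X m i"
    using assms by (auto simp: is_colored_def)
  have t: "0 \<le> Poly_Mapping.lookup (mu q i m) n * (Poly_Mapping.lookup (pol X) m - col X m i)" for n
    using mu_nonneg d by (rule mult_nonneg_nonneg)
  show ?thesis
    using assms(1) t
    by (auto simp: is_colored_def expand_def Let_def expand_pol.rep_eq in_keys_iff
        intro: order_trans max.coboundedI1)
qed


section \<open>The algorithm\<close>

definition FM_start :: "monomial \<Rightarrow> colored" where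
  "FM_start m = \<lparr>pol = Poly_Mapping.single m 1, col = (\<lambda>_ _. 0)\<rparr>"

lemma is_colored_FM_start: "is_colored (FM_start m)"
  by (simp add: is_colored_def FM_start_def)

definition monomials_at :: "weight \<Rightarrow> colored \<Rightarrow> monomial set" where
  "monomials_at \<kappa> X = {m \<in> Poly_Mapping.keys (pol X). monomial_weight m = \<kappa>}"

definition all_admissible_at :: "weight \<Rightarrow> colored \<Rightarrow> bool" where
  "all_admissible_at \<kappa> X \<longleftrightarrow> (\<forall>m\<in>monomials_at \<kappa> X. admissible X m)"

text \<open>
  Performing all expansions at weight \<open>\<kappa>\<close>, one after the other in an arbitrary order.
\<close>

definition expands_at :: "complex \<Rightarrow> weight \<Rightarrow> colored \<Rightarrow> colored \<Rightarrow> bool" where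
  "expands_at q \<kappa> X X' \<longleftrightarrow>
     (\<exists>ps. distinct ps \<and> set ps = UNIV \<times> monomials_at \<kappa> X \<and>
           X' = fold (\<lambda>(i, m). expand q i m) ps X)"

text \<open>
  \<open>R\<close> is a total order on the weights below \<open>top_wt\<close> compatible with the natural order
  (\<open>(\<mu>, \<nu>) \<in> R\<close> meaning that \<open>\<mu>\<close> is at most \<open>\<nu>\<close>), and \<open>lam\<close> enumerates these weights in
  strictly decreasing order, with indices starting at \<open>0\<close>.
\<close>

definition FM_enumeration :: "weight \<Rightarrow> weight rel \<Rightarrow> (nat \<Rightarrow> weight) \<Rightarrow> bool" where
  "FM_enumeration top_wt R lam \<longleftrightarrow>
     linear_order_on {\<mu>. weight_le \<mu> top_wt} R \<and>
     (\<forall>\<mu> \<nu>. weight_le \<mu> top_wt \<and> weight_le \<nu> top_wt \<and> weight_le \<mu> \<nu> \<longrightarrow> (\<mu>, \<nu>) \<in> R) \<and>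
     range lam = {\<mu>. weight_le \<mu> top_wt} \<and>
     lam 0 = top_wt \<and>
     (\<forall>k l. k < l \<longrightarrow> (lam l, lam k) \<in> R \<and> lam l \<noteq> lam k)"

text \<open>
  \<open>X k\<close> is the current colored polynomial when \<open>lam k\<close> is about to be treated.  Nothing is
  required after a halt.  After a completion the expansions are over empty sets of monomials, so
  the sequence is merely constant.
\<close>

definition FM_run :: "complex \<Rightarrow> monomial \<Rightarrow> (nat \<Rightarrow> weight) \<Rightarrow> (nat \<Rightarrow> colored) \<Rightarrow> bool" where
  "FM_run q m lam X \<longleftrightarrow>
     X 0 = FM_start m \<and>
     (\<forall>k. (\<forall>j\<le>k. all_admissible_at (lam j) (X j)) \<longrightarrow> expands_at q (lam k) (X k) (X (Suc k)))"

text \<open>The stopping criterion, tested on the polynomial after the expansions at weight \<open>\<kappa>\<close>.\<close>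

definition FM_stops :: "weight rel \<Rightarrow> weight \<Rightarrow> colored \<Rightarrow> bool" where
  "FM_stops R \<kappa> X \<longleftrightarrow>
     \<not> (\<exists>n\<in>Poly_Mapping.keys (pol X). (monomial_weight n, \<kappa>) \<in> R \<and> monomial_weight n \<noteq> \<kappa>)"

definition FM_run_fails :: "weight rel \<Rightarrow> (nat \<Rightarrow> weight) \<Rightarrow> (nat \<Rightarrow> colored) \<Rightarrow> bool" where
  "FM_run_fails R lam X \<longleftrightarrow>
     (\<exists>k. (\<forall>j<k. all_admissible_at (lam j) (X j) \<and> \<not> FM_stops R (lam j) (X (Suc j))) \<and>
          (\<exists>m\<in>monomials_at (lam k) (X k). \<not> admissible (X k) m))"

text \<open>The algorithm fails if it does so for all choices left open by its description.\<close>

definition FM_fails :: "complex \<Rightarrow> monomial \<Rightarrow> bool" where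
  "FM_fails q m \<longleftrightarrow>
     (\<forall>R lam X. FM_enumeration (monomial_weight m) R lam \<longrightarrow> FM_run q m lam X \<longrightarrow>
        FM_run_fails R lam X)"

end

theory Submission
  imports Defs
begin

text \<open>
  Write \<open>m\<^sub>+\<close> for the initial monomial, with exponents written additively.  The algorithm is
  forced to produce the chain

    \<open>m\<^sub>+\<close>,  \<open>m\<^sub>+ - A\<^bsub>3,1\<^esub>\<close>,  \<open>m\<^sub>+ - A\<^bsub>3,1\<^esub> - 2 A\<^bsub>2,q^2\<^esub>\<close>,
    \<open>m\<^sub>* = m\<^sub>+ - A\<^bsub>3,1\<^esub> - 2 A\<^bsub>2,q^2\<^esub> - A\<^bsub>1,q^3\<^esub>\<close>

  by a \<open>3\<close>-, a \<open>2\<close>- and a \<open>1\<close>-expansion.  The exponent of \<open>Y\<^bsub>2,q^3\<^esub>\<close> in \<open>m\<^sub>*\<close> is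
  \<open>-1\<close>, so \<open>m\<^sub>*\<close> is not \<open>2\<close>-dominant; it is therefore not admissible as soon as its color
  \<open>2\<close> is \<open>0\<close>.  That color could become positive only through the \<open>2\<close>-expansion of a monomial
  that has fewer factors \<open>A\<^bsub>2,q^2\<^esub>\<close> removed from \<open>m\<^sub>+\<close> but already has \<open>A\<^bsub>1,q^3\<^esub>\<close> removed.
  Such monomials never occur: \<open>m\<^sub>+\<close> contains \<open>Y\<^bsub>1,q^4\<^esub>\<close>, and removing \<open>A\<^bsub>2,q^2\<^esub>\<close> once supplies
  one factor \<open>Y\<^bsub>1,q^2\<^esub>\<close>, which joins \<open>Y\<^bsub>1,q^4\<^esub>\<close> in the string \<open>{q^2, q^4}\<close>; the \<open>1\<close>-expansion
  then has to remove \<open>A\<^bsub>1,q^5\<^esub>\<close> before \<open>A\<^bsub>1,q^3\<^esub>\<close>.  Only a second factor \<open>Y\<^bsub>1,q^2\<^esub>\<close>, a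
  string of its own, makes \<open>A\<^bsub>1,q^3\<^esub>\<close> removable first.

  Three ingredients make this an argument about all runs.  The \<open>A\<^bsub>i,a\<^esub>\<close> are independent
  (\<open>A_product_inject\<close>), so the multiset of factors removed from \<open>m\<^sub>+\<close> can be read off a monomial,
  and it can only grow along expansions (\<open>keys_mu\<close>).  The string factorizations that occur involve
  two neighbouring points only and are determined in \<open>string_factorization_pair\<close>.  Finally
  \<open>FM_fails_criterion\<close> takes care of the order of weights, the order of the expansions and the
  coefficients: color \<open>i\<close> of a monomial stays \<open>0\<close> up to its own turn if no other monomial
  that can occur reaches it by an \<open>i\<close>-expansion.
\<close>

section \<open>Independence of the monomials \<open>A\<^bsub>i,a\<^esub>\<close>\<close>

text \<open>
  The content of a monomial, namely the factors \<open>A\<^bsub>i,a\<^esub>\<close> that were removed from the initial one,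
  is recorded as a multiset of index pairs.
\<close>

definition A_product :: "complex \<Rightarrow> (node \<times> complex) multiset \<Rightarrow> monomial" where
  "A_product q U = (\<Sum>(i, a)\<in>#U. A q i a)"

lemma A_product_simps [simp]:
  "A_product q {#} = 0"
  "A_product q (add_mset (i, a) U) = A q i a + A_product q U"
  "A_product q (U + V) = A_product q U + A_product q V"
  by (simp_all add: A_product_def)

lemma lookup_Y: "Poly_Mapping.lookup (Y i a) x = (if x = (i, a) then 1 else 0)"
  by (auto simp: Y_def lookup_single when_def)

text \<open>
  Among the variables of \<open>A\<^bsub>i,a\<^esub>\<close>, the one furthest along its \<open>q\<close>-orbit is \<open>Y\<^bsub>i,a q_i\<^esub>\<close>.  Hence
  any other \<open>A\<^bsub>j,b\<^esub>\<close> that involves this variable reaches strictly further, which orders the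
  \<open>A\<^bsub>i,a\<^esub>\<close> triangularly.
\<close>

lemma lookup_A_right:
  assumes "q \<noteq> 0" "Poly_Mapping.lookup (A q j b) (i, a * q_node q i) \<noteq> 0" "(j, b) \<noteq> (i, a)"
  shows "\<exists>k>0. b * q_node q j = a * q_node q i * q ^ k"
proof (cases j)
  case N1
  consider "i = N1" "b / q = a * q_node q i" | "i = N1" "b * q = a * q_node q i"
    | "i = N2" "b = a * q_node q i"
    using assms(2) N1 by (auto simp: lookup_add lookup_minus lookup_Y split: if_splits)
  then show ?thesis
  proof cases
    case 1 then show ?thesis using assms(1) N1 by (intro exI[of _ 2]) (auto simp: field_simps power2_eq_square)
  next
    case 2 then show ?thesis using assms(1,3) N1 by auto
  next
    case 3 then show ?thesis using assms(1) N1 by (intro exI[of _ 1]) auto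
  qed
next
  case N2
  consider "i = N2" "b / q = a * q_node q i" | "i = N2" "b * q = a * q_node q i"
    | "i = N1 \<or> i = N3" "b = a * q_node q i"
    using assms(2) N2 by (auto simp: lookup_add lookup_minus lookup_Y split: if_splits)
  then show ?thesis
  proof cases
    case 1 then show ?thesis using assms(1) N2 by (intro exI[of _ 2]) (auto simp: field_simps power2_eq_square)
  next
    case 2 then show ?thesis using assms(1,3) N2 by auto
  next
    case 3 then show ?thesis using assms(1) N2 by (intro exI[of _ 1]) auto
  qed
next
  case N3
  consider "i = N3" "b / q ^ 2 = a * q_node q i" | "i = N3" "b * q ^ 2 = a * q_node q i"
    | "i = N2" "b / q = a * q_node q i" | "i = N2" "b * q = a * q_node q i"
    using assms(2) N3 by (auto simp: lookup_add lookup_minus lookup_Y split: if_splits)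
  then show ?thesis
  proof cases
    case 1 then show ?thesis using assms(1) N3 by (intro exI[of _ 4]) (auto simp: field_simps power_numeral_reduce)
  next
    case 2 then show ?thesis using assms(1,3) N3 by auto
  next
    case 3 then show ?thesis using assms(1) N3 by (intro exI[of _ 3]) (auto simp: field_simps power_numeral_reduce)
  next
    case 4 then show ?thesis using assms(1) N3 by (intro exI[of _ 1]) (auto simp: field_simps power_numeral_reduce)
  qed
qed

lemma lookup_A_self_pos:
  assumes "q \<noteq> 0"
  shows "0 < Poly_Mapping.lookup (A q i a) (i, a * q_node q i)"
  by (cases i) (auto simp: lookup_add lookup_minus lookup_Y)

text \<open>
  At the spectral parameter \<open>0\<close>, which multiplication by \<open>q\<close> fixes, there is no direction to move
  in; there the exponents are given by the Cartan matrix, whose invertibility recovers the content.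
  This case matters because \<open>mu\<close> is built on a definite description, so nothing is known about the
  parameters in it before a factorization has been exhibited.
\<close>

lemma lookup_A_product_at_zero:
  assumes "q \<noteq> 0"
  shows "Poly_Mapping.lookup (A_product q U) (N1, 0)
      = 2 * int (count U (N1, 0)) - int (count U (N2, 0))"
    and "Poly_Mapping.lookup (A_product q U) (N2, 0)
      = - int (count U (N1, 0)) + 2 * int (count U (N2, 0)) - 2 * int (count U (N3, 0))"
    and "Poly_Mapping.lookup (A_product q U) (N3, 0)
      = - int (count U (N2, 0)) + 2 * int (count U (N3, 0))"
proof -
  have "Poly_Mapping.lookup (A_product q U) (N1, 0)
      = 2 * int (count U (N1, 0)) - int (count U (N2, 0))
    \<and> Poly_Mapping.lookup (A_product q U) (N2, 0)
      = - int (count U (N1, 0)) + 2 * int (count U (N2, 0)) - 2 * int (count U (N3, 0))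
    \<and> Poly_Mapping.lookup (A_product q U) (N3, 0)
      = - int (count U (N2, 0)) + 2 * int (count U (N3, 0))"
  proof (induction U)
    case empty
    then show ?case by simp
  next
    case (add x U)
    obtain i a where x: "x = (i, a)" by force
    then show ?case
      using add assms by (cases i) (auto simp: lookup_add lookup_minus lookup_Y)
  qed
  then show "Poly_Mapping.lookup (A_product q U) (N1, 0)
      = 2 * int (count U (N1, 0)) - int (count U (N2, 0))"
    and "Poly_Mapping.lookup (A_product q U) (N2, 0)
      = - int (count U (N1, 0)) + 2 * int (count U (N2, 0)) - 2 * int (count U (N3, 0))"
    and "Poly_Mapping.lookup (A_product q U) (N3, 0)
      = - int (count U (N2, 0)) + 2 * int (count U (N3, 0))"
    by blast+
qed

text \<open>
  If the two products have no factor in common but are not both trivial, choose a factor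
  \<open>A\<^bsub>i,a\<^esub>\<close> that is maximal with respect to moving along \<open>q\<close>-orbits.  Its extreme variable
  \<open>Y\<^bsub>i,a q_i\<^esub>\<close> occurs in no other factor, so its exponent is nonzero in one product and zero in the
  other.  That \<open>q\<close> is not a root of unity makes the orbit order irreflexive.
\<close>

lemma A_product_disjoint_eq:
  assumes q: "q \<noteq> 0" "\<forall>n::nat. 0 < n \<longrightarrow> q ^ n \<noteq> 1"
    and eq: "A_product q U = A_product q V" and disj: "U \<inter># V = {#}"
  shows "U = {#} \<and> V = {#}"
proof (rule ccontr)
  assume "\<not> (U = {#} \<and> V = {#})"
  then have ne: "set_mset U \<union> set_mset V \<noteq> {}" by simp
  have c0: "count U (i, 0) = 0 \<and> count V (i, 0) = 0" for i
  proof -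
    have "min (count U (i, 0)) (count V (i, 0)) = 0"
      using disj by (metis count_empty count_inter_mset)
    moreover have "count U (i, 0) = count V (i, 0)"
      using lookup_A_product_at_zero[OF q(1), of U] lookup_A_product_at_zero[OF q(1), of V] eq
      by (cases i) auto
    ultimately show ?thesis by simp
  qed
  have nz: "a \<noteq> 0" if "(i, a) \<in> set_mset U \<union> set_mset V" for i a
    using c0[of i] that by (auto simp: count_eq_zero_iff)
  \<comment> \<open>\<open>R x y\<close>: the extreme variable of \<open>y\<close> lies further along the orbit than that of \<open>x\<close>.\<close>
  define R where "R = (\<lambda>x y. \<exists>k>0. snd y * q_node q (fst y) = snd x * q_node q (fst x) * q ^ k)"
  have q_node_nz: "q_node q i \<noteq> 0" for i using q(1) by (cases i) auto
  have "transp_on (set_mset U \<union> set_mset V) R"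
  proof (rule transp_onI)
    fix x y z assume "R x y" "R y z"
    then obtain k l where kl: "k > 0" "snd y * q_node q (fst y) = snd x * q_node q (fst x) * q ^ k"
      "snd z * q_node q (fst z) = snd y * q_node q (fst y) * q ^ l"
      unfolding R_def by blast
    then have "snd z * q_node q (fst z) = snd x * q_node q (fst x) * q ^ (k + l)"
      by (simp add: power_add)
    then show "R x z" unfolding R_def using kl(1) by (intro exI[of _ "k + l"]) simp
  qed
  moreover have "asymp_on (set_mset U \<union> set_mset V) R"
  proof (rule asymp_onI, rule notI)
    fix x y assume x: "x \<in> set_mset U \<union> set_mset V" and "R x y" "R y x"
    then obtain k l where kl: "k > 0" "snd y * q_node q (fst y) = snd x * q_node q (fst x) * q ^ k"
      "snd x * q_node q (fst x) = snd y * q_node q (fst y) * q ^ l"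
      unfolding R_def by blast
    have "snd x * q_node q (fst x) = snd y * q_node q (fst y) * q ^ l" by (rule kl(3))
    also have "\<dots> = snd x * q_node q (fst x) * q ^ k * q ^ l" by (subst kl(2)) (rule refl)
    also have "\<dots> = snd x * q_node q (fst x) * q ^ (k + l)"
      by (simp add: power_add)
    finally have "snd x * q_node q (fst x) = snd x * q_node q (fst x) * q ^ (k + l)" .
    moreover have "snd x \<noteq> 0" using nz[of "fst x" "snd x"] x by simp
    ultimately have "q ^ (k + l) = 1"
      using q_node_nz[of "fst x"] by (metis mult_cancel_left1 mult_eq_0_iff)
    then show False using q(2) kl(1) by simp
  qed
  ultimately obtain x where x: "x \<in> set_mset U \<union> set_mset V"
    and max: "\<forall>y\<in>set_mset U \<union> set_mset V. y \<noteq> x \<longrightarrow> \<not> R x y"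
    using Finite_Set.bex_max_element[OF _ _ _ ne, of R] by auto
  obtain i a where ia: "x = (i, a)" by force
  have other: "Poly_Mapping.lookup (A q j b) (i, a * q_node q i) = 0"
    if "(j, b) \<in> set_mset U \<union> set_mset V" "(j, b) \<noteq> (i, a)" for j b
  proof (rule ccontr)
    assume "Poly_Mapping.lookup (A q j b) (i, a * q_node q i) \<noteq> 0"
    then have "R x (j, b)"
      using lookup_A_right[OF q(1) _ that(2)] unfolding R_def ia by simp
    then show False using max that ia by blast
  qed
  define c where "c = Poly_Mapping.lookup (A q i a) (i, a * q_node q i)"
  have c: "c > 0" unfolding c_def by (rule lookup_A_self_pos[OF q(1)])
  have val: "Poly_Mapping.lookup (A_product q W) (i, a * q_node q i) = c * int (count W x)"
    if "set_mset W \<subseteq> set_mset U \<union> set_mset V" for W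
    using that
  proof (induction W)
    case empty
    then show ?case by simp
  next
    case (add y W)
    then show ?case
      using other[of "fst y" "snd y"]
      by (cases y) (auto simp: lookup_add ia c_def algebra_simps)
  qed
  have "c * int (count U x) = c * int (count V x)"
    using val[of U] val[of V] unfolding eq by (metis Un_upper1 Un_upper2)
  then have "count U x = count V x" using c by simp
  moreover have "min (count U x) (count V x) = 0"
    using disj by (metis count_empty count_inter_mset)
  moreover have "0 < count U x + count V x" using x by auto
  ultimately show False by simp
qed

theorem A_product_inject:
  assumes "q \<noteq> 0" "\<forall>n::nat. 0 < n \<longrightarrow> q ^ n \<noteq> 1" "A_product q U = A_product q V"
  shows "U = V"
proof -
  have U: "U = (U - V) + (U \<inter># V)" and V: "V = (V - U) + (U \<inter># V)"
    by (auto simp: multiset_eq_iff)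
  have "A_product q (U - V) = A_product q (V - U)"
    using assms(3) A_product_simps(3)[of q "U - V" "U \<inter># V"] A_product_simps(3)[of q "V - U" "U \<inter># V"]
    unfolding U[symmetric] V[symmetric] by simp
  moreover have "(U - V) \<inter># (V - U) = {#}"
    by (auto simp: multiset_eq_iff)
  ultimately show ?thesis
    using A_product_disjoint_eq[OF assms(1,2)] U V by (metis add_0)
qed

section \<open>Monomials of \<open>\<mu>\<close> and their weights\<close>

text \<open>
  Every summand of every factor of \<open>\<mu>\<close> is a product of inverses of \<open>A\<^bsub>i,a\<^esub>\<close>, whatever
  multiset of pairs \<open>(a, r)\<close> the definite description in \<open>mu\<close> denotes.
\<close>

lemma keys_mu:
  assumes "n \<in> Poly_Mapping.keys (mu q i m)"
  obtains S where "n = m - A_product q (image_mset (Pair i) S)"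
proof -
  \<comment> \<open>The exponent vectors that a factor of the product may contribute.\<close>
  define C where "C = {- A_product q (image_mset (Pair i) S) | S. True}"
  have sum_in: "- (\<Sum>j = 1..l. A q i (h j)) \<in> C" for l :: nat and h :: "nat \<Rightarrow> complex"
    unfolding C_def
    by (rule CollectI, rule exI[of _ "image_mset h (mset_set {1..l})"])
      (simp add: A_product_def sum_unfold_sum_mset image_mset.compositionality comp_def)
  have add_in: "x + y \<in> C" if xy: "x \<in> C" "y \<in> C" for x y
  proof -
    from xy obtain S T where "x = - A_product q (image_mset (Pair i) S)"
      "y = - A_product q (image_mset (Pair i) T)" by (auto simp: C_def)
    then have "x + y = - A_product q (image_mset (Pair i) (S + T))" by simp
    then show ?thesis unfolding C_def by blast
  qed
  have zero_in: "0 \<in> C" unfolding C_def by (rule CollectI, rule exI[of _ "{#}"]) simp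
  define F where "F = (\<lambda>(a, r). \<Sum>l = 0..r. Poly_Mapping.single
          (- (\<Sum>j = 1..l. A q i (a * q_node q i powi (int r - 2 * int j + 2)))) (1::int))"
  have F: "Poly_Mapping.keys (F x) \<subseteq> C" for x
  proof (cases x)
    case (Pair a r)
    have "Poly_Mapping.keys (Poly_Mapping.single
          (- (\<Sum>j = 1..l. A q i (a * q_node q i powi (int r - 2 * int j + 2)))) (1::int)) \<subseteq> C" for l
      using sum_in[of "\<lambda>j. a * q_node q i powi (int r - 2 * int j + 2)" l] by simp
    then show ?thesis unfolding F_def Pair prod.case
      by (intro order_trans[OF keys_sum] UN_least)
  qed
  have "Poly_Mapping.keys (\<Prod>x\<in>#M. F x) \<subseteq> C" for M
  proof (induction M)
    case empty
    then show ?case using zero_in by simp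
  next
    case (add x M)
    have "y \<in> C" if y: "y \<in> Poly_Mapping.keys (F x * (\<Prod>x\<in>#M. F x))" for y
    proof -
      obtain a b where "y = a + b" "a \<in> Poly_Mapping.keys (F x)"
        "b \<in> Poly_Mapping.keys (\<Prod>x\<in>#M. F x)"
        using subsetD[OF keys_mult y] by auto
      then show ?thesis using F[of x] add.IH add_in by auto
    qed
    then show ?case by auto
  qed
  moreover obtain a b where "n = a + b" "a \<in> Poly_Mapping.keys (Poly_Mapping.single m (1::int))"
    "b \<in> Poly_Mapping.keys (\<Prod>x\<in>#(THE M. string_factorization q i m M). F x)"
    using subsetD[OF keys_mult assms[unfolded mu_def, folded F_def]] by auto
  ultimately have "n - m \<in> C" by auto
  then obtain S where "n - m = - A_product q (image_mset (Pair i) S)"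
    unfolding C_def by auto
  then have "n = m - A_product q (image_mset (Pair i) S)"
    by (simp add: algebra_simps)
  then show ?thesis by (rule that)
qed

lemma monomial_weight_eq_sum:
  assumes "finite S" "Poly_Mapping.keys m \<subseteq> S"
  shows "monomial_weight m = (\<Sum>x\<in>S. Poly_Mapping.lookup m x *s \<omega> (fst x))"
proof -
  have "monomial_weight m = (\<Sum>x\<in>Poly_Mapping.keys m. Poly_Mapping.lookup m x *s \<omega> (fst x))"
    by (simp add: monomial_weight_def case_prod_unfold)
  also have "\<dots> = (\<Sum>x\<in>S. Poly_Mapping.lookup m x *s \<omega> (fst x))"
    using assms by (intro sum.mono_neutral_left) (auto simp: in_keys_iff)
  finally show ?thesis .
qed

lemma monomial_weight_add: "monomial_weight (m + n) = monomial_weight m + monomial_weight n"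
proof -
  define S where "S = Poly_Mapping.keys m \<union> Poly_Mapping.keys n \<union> Poly_Mapping.keys (m + n)"
  have S: "finite S" "Poly_Mapping.keys m \<subseteq> S" "Poly_Mapping.keys n \<subseteq> S" "Poly_Mapping.keys (m + n) \<subseteq> S"
    by (auto simp: S_def)
  show ?thesis
    using S by (simp add: monomial_weight_eq_sum[of S] lookup_add vector_sadd_rdistrib sum.distrib)
qed

lemma monomial_weight_diff: "monomial_weight (m - n) = monomial_weight m - monomial_weight n"
  using monomial_weight_add[of "m - n" n] by simp

lemma monomial_weight_Y: "monomial_weight (Y i a) = \<omega> i"
  by (simp add: Y_def monomial_weight_def)

lemma monomial_weight_A: "monomial_weight (A q i a) = \<alpha> i"
  by (cases i) (simp_all add: monomial_weight_add monomial_weight_diff monomial_weight_Y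
      vec_eq_iff)

lemma monomial_weight_A_product:
  "monomial_weight (A_product q (image_mset (Pair i) S)) = int (size S) *s \<alpha> i"
proof (induction S)
  case empty
  then show ?case by (simp add: monomial_weight_def)
next
  case (add x S)
  then show ?case
    by (simp add: monomial_weight_add monomial_weight_A vector_sadd_rdistrib)
qed

lemma \<alpha>_nonzero: "\<alpha> i \<noteq> 0"
proof
  assume "\<alpha> i = 0"
  then have "\<alpha> i $ i = 0" by simp
  then show False by (cases i) (simp_all add: \<omega>_def axis_def)
qed

text \<open>
  An expansion only creates monomials of strictly smaller weight, so the algorithm cannot change a
  monomial after its weight has been treated.
\<close>

lemma weight_less_keys_mu:
  assumes "n \<in> Poly_Mapping.keys (mu q i m)" "n \<noteq> m"
  shows "weight_le (monomial_weight n) (monomial_weight m)"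
    and "monomial_weight n \<noteq> monomial_weight m"
proof -
  obtain S where n: "n = m - A_product q (image_mset (Pair i) S)"
    using keys_mu assms(1) by metis
  have diff: "monomial_weight m - monomial_weight n = int (size S) *s \<alpha> i"
    by (simp add: n monomial_weight_diff monomial_weight_A_product)
  also have "\<dots> = (\<Sum>j\<in>UNIV. int (if j = i then size S else 0) *s \<alpha> j)"
    by (simp add: if_distrib[of int] if_distrib[of "\<lambda>c. c *s _"] sum.delta cong: if_cong)
  finally show "weight_le (monomial_weight n) (monomial_weight m)"
    unfolding weight_le_def by (rule exI[of _ "\<lambda>j. if j = i then size S else 0"])
  have "S \<noteq> {#}" using assms(2) n by auto
  obtain k where k: "\<alpha> i $ k \<noteq> 0" using \<alpha>_nonzero[of i] by (auto simp: vec_eq_iff)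
  show "monomial_weight n \<noteq> monomial_weight m"
  proof
    assume "monomial_weight n = monomial_weight m"
    then have "int (size S) * \<alpha> i $ k = 0"
      by (metis diff diff_self vector_smult_component zero_index)
    with k \<open>S \<noteq> {#}\<close> show False by auto
  qed
qed

section \<open>Factorization into strings on a pair of neighbouring points\<close>

lemma lookup_bar: "Poly_Mapping.lookup (bar i m) a = Poly_Mapping.lookup m (i, a)"
  by (simp add: bar_def map_key.rep_eq inj_on_def)

lemma bar_add: "bar i (m + n) = bar i m + bar i n"
  by (rule poly_mapping_eqI) (simp add: lookup_bar lookup_add)

lemma bar_diff: "bar i (m - n) = bar i m - bar i n"
  by (rule poly_mapping_eqI) (simp add: lookup_bar lookup_minus)

lemma bar_Y: "bar i (Y j a) = (if i = j then Poly_Mapping.single a 1 else 0)"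
  by (rule poly_mapping_eqI) (auto simp: lookup_bar lookup_Y lookup_single when_def)

lemma bar_zero: "bar i 0 = 0"
  by (rule poly_mapping_eqI) (simp add: lookup_bar)

lemmas bar_simps = bar_zero bar_add bar_diff bar_Y

text \<open>
  The exponent at a point is the number of strings through it; comparing exponents thus turns into
  counting strings.
\<close>

lemma lookup_string_product:
  "Poly_Mapping.lookup (\<Sum>(a, r)\<in>#M. \<Sum>b\<in>qstring p a r. Poly_Mapping.single b (1::int)) c
     = int (size (filter_mset (\<lambda>(a, r). c \<in> qstring p a r) M))"
proof (induction M)
  case empty
  then show ?case by simp
next
  case (add x M)
  have "finite (qstring p a r)" for a r by (simp add: qstring_def)
  then show ?case using add
    by (cases x) (simp add: lookup_add lookup_sum lookup_single when_def)
qed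

lemma size_filter_replicate_mset:
  "size (filter_mset P (replicate_mset k y)) = (if P y then k else 0)"
  by (induction k) auto

lemma qstring_1 [simp]: "qstring p a (Suc 0) = {a}"
  by (simp add: qstring_def)

lemma qstring_2: "qstring p a 2 = {a / p, a * p}"
proof -
  have "{1..2::nat} = {1, 2}" by auto
  then show ?thesis by (auto simp: qstring_def power_int_minus field_simps)
qed

text \<open>
  A string has as many distinct points as its length, and its points are consecutive, so only the
  two singletons and the whole pair fit into the pair.
\<close>

lemma qstring_within_pair:
  assumes p: "p \<noteq> 0" "\<forall>n::nat. 0 < n \<longrightarrow> p ^ n \<noteq> 1" and x: "x \<noteq> 0" and a: "a \<noteq> 0" "1 \<le> r"
    and sub: "qstring p a r \<subseteq> {x, x * p ^ 2}"
  shows "(a, r) \<in> {(x, 1), (x * p ^ 2, 1), (x * p, 2)}"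
proof -
  have p2: "p ^ 2 \<noteq> 1" "p ^ 4 \<noteq> 1" using p(2) by simp_all
  have mem: "a * p powi (int r - 2 * int k + 1) \<in> {x, x * p ^ 2}" if "1 \<le> k" "k \<le> r" for k
  proof -
    have "a * p powi (int r - 2 * int k + 1) \<in> qstring p a r"
      unfolding qstring_def using that by (intro image_eqI[of _ _ k]) auto
    then show ?thesis using sub by blast
  qed
  have ratio: "a * p powi (int r - 2 * int k + 1) = a * p powi (int r - 2 * int l + 1) * p ^ (2 * (l - k))"
    if "k \<le> l" for k l
  proof -
    have "int r - 2 * int k + 1 = (int r - 2 * int l + 1) + int (2 * (l - k))"
      using that by simp
    then have "p powi (int r - 2 * int k + 1) = p powi (int r - 2 * int l + 1) * p ^ (2 * (l - k))"
      using p(1) by (metis power_int_add power_int_of_nat)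
    then show ?thesis by simp
  qed
  have ne: "a * p powi (int r - 2 * int k + 1) \<noteq> a * p powi (int r - 2 * int l + 1)"
    if "k < l" for k l
  proof -
    have "p ^ (2 * (l - k)) \<noteq> 1" using p(2) that by simp
    then show ?thesis using ratio[of k l] that a p(1) by simp
  qed
  have "r \<le> 2"
  proof (rule ccontr)
    assume "\<not> r \<le> 2"
    then have r: "1 \<le> r" "2 \<le> r" "3 \<le> r" by simp_all
    define e where "e k = a * p powi (int r - 2 * int k + 1)" for k
    have "e k \<in> {x, x * p ^ 2}" if "1 \<le> k" "k \<le> r" for k
      unfolding e_def by (rule mem[OF that])
    from this[of 1] this[of 2] this[of 3]
    have "e 1 \<in> {x, x * p ^ 2}" "e 2 \<in> {x, x * p ^ 2}" "e 3 \<in> {x, x * p ^ 2}"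
      using r by simp_all
    moreover have "e k \<noteq> e l" if "k < l" for k l
      unfolding e_def by (rule ne[OF that])
    from this[of 1 2] this[of 2 3] this[of 1 3] have "e 1 \<noteq> e 2" "e 2 \<noteq> e 3" "e 1 \<noteq> e 3"
      by simp_all
    ultimately show False by auto
  qed
  then consider "r = 1" | "r = 2" using a(2) by linarith
  then show ?thesis
  proof cases
    case 1
    then show ?thesis using sub by auto
  next
    case 2
    have dich: "a / p = x \<or> a / p = x * p ^ 2" "a * p = x \<or> a * p = x * p ^ 2"
      using sub unfolding 2 qstring_2 by auto
    have shift: "a * p = (a / p) * p ^ 2" using p(1) by (simp add: power2_eq_square)
    have "a / p = x"
    proof (rule ccontr)
      assume "a / p \<noteq> x"
      then have "a / p = x * p ^ 2" using dich(1) by simp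
      then have "a * p = x * p ^ 4" using shift by (simp flip: power_add)
      moreover have "x * p ^ 4 \<noteq> x" using x p2(2) by simp
      moreover have "x * p ^ 4 \<noteq> x * p ^ 2"
      proof -
        have "p ^ 2 * p ^ 2 \<noteq> p ^ 2"
          using p2(1) p(1) by (metis mult_cancel_left1 power_eq_0_iff)
        then have "p ^ 4 \<noteq> p ^ 2" by (simp flip: power_add)
        then show ?thesis using x by simp
      qed
      ultimately show False using dich(2) by auto
    qed
    then have "a = x * p" using p(1) by (simp add: field_simps)
    then show ?thesis using 2 by simp
  qed
qed

text \<open>
  Let \<open>u\<close>, \<open>v\<close>, \<open>w\<close> be the numbers of strings \<open>{x}\<close>, \<open>{x p^2}\<close> and \<open>{x, x p^2}\<close>.  The
  exponents give \<open>u + w = s\<close> and \<open>v + w = t\<close>, and general position forbids the two singletons to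
  occur together, since their union is a string.  So \<open>u = 0\<close> or \<open>v = 0\<close>, which determines all
  three numbers.
\<close>

theorem string_factorization_pair:
  fixes s t :: nat
  assumes p: "p = q_node q i" "p \<noteq> 0" "\<forall>n::nat. 0 < n \<longrightarrow> p ^ n \<noteq> 1" and x: "x \<noteq> 0"
    and bar: "bar i m = Poly_Mapping.single x (int s) + Poly_Mapping.single (x * p ^ 2) (int t)"
  shows "string_factorization q i m M \<longleftrightarrow>
    M = replicate_mset (s - t) (x, 1) + replicate_mset (t - s) (x * p ^ 2, 1)
      + replicate_mset (min s t) (x * p, 2)"
    (is "_ \<longleftrightarrow> M = ?M")
proof -
  have p2: "p ^ 2 \<noteq> 1" "p ^ 4 \<noteq> 1" using p(3) by simp_all
  have xx: "x * p ^ 2 \<noteq> x" using x p2 by simp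
  have two: "qstring p (x * p) 2 = {x, x * p ^ 2}"
    using p(2) by (simp add: qstring_2 power2_eq_square mult.assoc)
  \<comment> \<open>The reason why the two singletons are not in general position.\<close>
  have uni: "is_qstring p {x, x * p ^ 2}"
    unfolding is_qstring_def using two x p(2) by (intro exI[of _ "x * p"] exI[of _ 2]) simp
  show ?thesis
  proof
    assume M: "string_factorization q i m M"
    have pos: "a \<noteq> 0 \<and> 1 \<le> r" if "(a, r) \<in># M" for a r
      using M that by (auto simp: string_factorization_def)
    have gp: "general_position p (qstring p a r) (qstring p b s')"
      if "(a, r) \<in># M" "(b, s') \<in># M" for a b r s'
      using M that unfolding string_factorization_def p(1) by blast
    have cnt: "int (size (filter_mset (\<lambda>(a, r). c \<in> qstring p a r) M))
        = (if c = x then int s else if c = x * p ^ 2 then int t else 0)" for c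
    proof -
      have "bar i m = (\<Sum>(a, r)\<in>#M. \<Sum>b\<in>qstring p a r. Poly_Mapping.single b 1)"
        using M unfolding string_factorization_def p(1)[symmetric] by blast
      then have "Poly_Mapping.lookup (bar i m) c
          = int (size (filter_mset (\<lambda>(a, r). c \<in> qstring p a r) M))"
        by (simp only: lookup_string_product)
      then show ?thesis
        using xx unfolding bar by (auto simp: lookup_add lookup_single when_def)
    qed
    have elem: "y \<in> {(x, 1), (x * p ^ 2, 1), (x * p, 2)}" if "y \<in># M" for y
    proof -
      obtain a r where y: "y = (a, r)" by force
      have "c \<in> {x, x * p ^ 2}" if "c \<in> qstring p a r" for c
      proof (rule ccontr)
        assume "c \<notin> {x, x * p ^ 2}"
        then have none: "filter_mset (\<lambda>(a, r). c \<in> qstring p a r) M = {#}"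
          using cnt[of c] by simp
        have "y \<in># filter_mset (\<lambda>(a, r). c \<in> qstring p a r) M"
          using \<open>y \<in># M\<close> that y by simp
        then show False unfolding none by simp
      qed
      then show ?thesis
        using qstring_within_pair[OF p(2,3) x, of a r] pos[of a r] \<open>y \<in># M\<close> y by blast
    qed
    define u v w where "u = count M (x, 1)" and "v = count M (x * p ^ 2, 1)"
      and "w = count M (x * p, 2)"
    have Meq: "M = replicate_mset u (x, 1) + replicate_mset v (x * p ^ 2, 1)
        + replicate_mset w (x * p, 2)"
    proof (rule multiset_eqI)
      fix y
      show "count M y = count (replicate_mset u (x, 1) + replicate_mset v (x * p ^ 2, 1)
        + replicate_mset w (x * p, 2)) y"
        using elem[of y] xx by (cases "y \<in># M") (auto simp: u_def v_def w_def not_in_iff)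
    qed
    have filt: "size (filter_mset P M) = (if P (x, 1) then u else 0)
        + (if P (x * p ^ 2, 1) then v else 0) + (if P (x * p, 2) then w else 0)" for P
      unfolding Meq filter_union_mset size_union size_filter_replicate_mset by (rule refl)
    have "u + w = s" using cnt[of x] xx two by (simp add: filt)
    moreover have "v + w = t" using cnt[of "x * p ^ 2"] xx two by (simp add: filt)
    moreover have "u = 0 \<or> v = 0"
    proof (rule ccontr)
      assume "\<not> (u = 0 \<or> v = 0)"
      then have "(x, 1) \<in># M" "(x * p ^ 2, 1) \<in># M" by (auto simp: u_def v_def not_in_iff)
      then show False using gp[of x 1 "x * p ^ 2" 1] uni xx
        by (auto simp: general_position_def insert_commute)
    qed
    ultimately have "u = s - t" "v = t - s" "w = min s t" by auto
    then show "M = ?M" using Meq by simp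
  next
    assume M: "M = ?M"
    have one: "(x, 1) \<notin># M \<or> (x * p ^ 2, 1) \<notin># M"
      using xx unfolding M by auto
    have elem: "y \<in> {(x, 1), (x * p ^ 2, 1), (x * p, 2)}" if "y \<in># M" for y
      using that unfolding M by (auto split: if_splits)
    have gp: "general_position p (qstring p a r) (qstring p b s')"
      if "(a, r) \<in># M" "(b, s') \<in># M" for a r b s'
      using elem[OF that(1)] elem[OF that(2)] one that by (auto simp: general_position_def two)
    have "\<forall>(a, r)\<in>#M. \<forall>(b, s')\<in>#M. general_position p (qstring p a r) (qstring p b s')"
      using gp by (intro ballI case_prodI2) simp
    moreover have "\<forall>(a, r)\<in>#M. a \<noteq> 0 \<and> 1 \<le> r"
      using elem x p(2) by fastforce
    moreover have "bar i m = (\<Sum>(a, r)\<in>#M. \<Sum>b\<in>qstring p a r. Poly_Mapping.single b 1)"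
    proof (rule poly_mapping_eqI)
      fix c
      show "Poly_Mapping.lookup (bar i m) c
        = Poly_Mapping.lookup (\<Sum>(a, r)\<in>#M. \<Sum>b\<in>qstring p a r. Poly_Mapping.single b 1) c"
      proof -
        have "int (size (filter_mset (\<lambda>(a, r). c \<in> qstring p a r) M))
            = (if c = x then int (s - t) else 0) + (if c = x * p ^ 2 then int (t - s) else 0)
              + (if c = x \<or> c = x * p ^ 2 then int (min s t) else 0)"
          unfolding M filter_union_mset size_union size_filter_replicate_mset prod.case two
          by simp
        also have "\<dots> = (if c = x then int s else if c = x * p ^ 2 then int t else 0)"
          using xx by (cases "c = x"; cases "c = x * p ^ 2") auto
        also have "\<dots> = Poly_Mapping.lookup (bar i m) c"
          unfolding bar lookup_add lookup_single when_def using xx by auto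
        finally show ?thesis unfolding lookup_string_product by (rule sym)
      qed
    qed
    ultimately show "string_factorization q i m M"
      unfolding string_factorization_def p(1)[symmetric] by (intro conjI)
  qed
qed

lemma mu_pair:
  fixes s t :: nat
  assumes "p = q_node q i" "p \<noteq> 0" "\<forall>n::nat. 0 < n \<longrightarrow> p ^ n \<noteq> 1" and "x \<noteq> 0"
    and "bar i m = Poly_Mapping.single x (int s) + Poly_Mapping.single (x * p ^ 2) (int t)"
  shows "mu q i m = Poly_Mapping.single m 1
    * (1 + Poly_Mapping.single (- A q i (x * p)) 1) ^ (s - t)
    * (1 + Poly_Mapping.single (- A q i (x * p ^ 3)) 1) ^ (t - s)
    * (1 + Poly_Mapping.single (- A q i (x * p ^ 3)) 1
         + Poly_Mapping.single (- A q i (x * p ^ 3) - A q i (x * p)) 1) ^ (min s t)"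
proof -
  have the: "(THE M. string_factorization q i m M) = replicate_mset (s - t) (x, 1)
      + replicate_mset (t - s) (x * p ^ 2, 1) + replicate_mset (min s t) (x * p, 2)"
    using string_factorization_pair[OF assms] by simp
  have single: "(\<Sum>l = 0..1. Poly_Mapping.single
        (- (\<Sum>j = 1..l. A q i (y * p powi (int 1 - 2 * int j + 2)))) (1::int))
      = 1 + Poly_Mapping.single (- A q i (y * p)) 1" for y
    by simp
  have sets: "{0..2} = {0, 1, 2::nat}" "{Suc 0..2} = {1, 2::nat}" by auto
  have double: "(\<Sum>l = 0..2. Poly_Mapping.single
        (- (\<Sum>j = 1..l. A q i (x * p * p powi (int 2 - 2 * int j + 2)))) (1::int))
      = 1 + Poly_Mapping.single (- A q i (x * p ^ 3)) 1
         + Poly_Mapping.single (- A q i (x * p ^ 3) - A q i (x * p)) 1"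
    by (simp add: sets power2_eq_square power3_eq_cube mult.assoc add.assoc)
  have cube: "x * p ^ 2 * p = x * p ^ 3"
    by (simp add: power2_eq_square power3_eq_cube)
  show ?thesis
    unfolding mu_def the assms(1)[symmetric]
    by (simp only: image_mset_union image_replicate_mset prod_mset.union prod_mset_replicate_mset
        prod.case single double cube) (simp only: mult.assoc)
qed

section \<open>A criterion for failure\<close>

text \<open>
  Together with positivity of the coefficient, a vanishing color \<open>i\<close> says that the \<open>i\<close>-expansion of
  \<open>n\<close> is not void and that \<open>n\<close> has to be \<open>i\<close>-dominant to be admissible.
\<close>

definition uncolored :: "node \<Rightarrow> monomial \<Rightarrow> colored \<Rightarrow> bool" where
  "uncolored i n X \<longleftrightarrow> (n \<in> Poly_Mapping.keys (pol X) \<longrightarrow> col X n i = 0)"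

text \<open>
  The set \<open>G\<close> stands for a set of monomials that is known to contain all those that can occur.
\<close>

definition no_parent :: "complex \<Rightarrow> monomial set \<Rightarrow> node \<Rightarrow> monomial \<Rightarrow> bool" where
  "no_parent q G i n \<longleftrightarrow> (\<forall>m\<in>G. n \<in> Poly_Mapping.keys (mu q i m) \<longrightarrow> m = n)"

text \<open>
  Coefficients never decrease, because an expansion takes the maximum with the old coefficient,
  so a positive one stays positive.
\<close>

lemma keys_expand_mono:
  assumes "is_colored X"
  shows "Poly_Mapping.keys (pol X) \<subseteq> Poly_Mapping.keys (pol (expand q i m X))"
proof
  fix n assume n: "n \<in> Poly_Mapping.keys (pol X)"
  have "0 \<le> Poly_Mapping.lookup (pol X) n"
    using assms n by (force simp: is_colored_def)
  with n show "n \<in> Poly_Mapping.keys (pol (expand q i m X))"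
    by (auto simp: expand_def Let_def in_keys_iff expand_pol.rep_eq)
qed

lemma keys_expand_subset:
  "Poly_Mapping.keys (pol (expand q i m X))
     \<subseteq> Poly_Mapping.keys (pol X) \<union> Poly_Mapping.keys (mu q i m)"
  by (auto simp: expand_def Let_def in_keys_iff expand_pol.rep_eq split: if_splits)

text \<open>
  A \<open>j\<close>-expansion assigns color \<open>0\<close> in all directions other than \<open>j\<close> to the monomials that it
  creates, and it leaves these colors alone on the monomials already present.
\<close>

lemma uncolored_expand:
  assumes "uncolored i n X" and "j \<noteq> i \<or> n \<notin> Poly_Mapping.keys (mu q j m)"
  shows "uncolored i n (expand q j m X)"
  using assms
  by (auto simp: uncolored_def expand_def Let_def in_keys_iff expand_pol.rep_eq split: if_splits)

lemma keys_mu_subset_expand: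
  assumes "is_colored X" "m \<in> Poly_Mapping.keys (pol X)" "uncolored i m X"
  shows "Poly_Mapping.keys (mu q i m) \<subseteq> Poly_Mapping.keys (pol (expand q i m X))"
proof
  fix n assume n: "n \<in> Poly_Mapping.keys (mu q i m)"
  have "0 \<le> Poly_Mapping.lookup (pol X) n"
    using assms(1) by (cases "n \<in> Poly_Mapping.keys (pol X)") (force simp: is_colored_def in_keys_iff)+
  with n assms(2,3) show "n \<in> Poly_Mapping.keys (pol (expand q i m X))"
    by (auto simp: uncolored_def expand_def Let_def in_keys_iff expand_pol.rep_eq)
qed

definition colored_within :: "monomial set \<Rightarrow> colored \<Rightarrow> bool" where
  "colored_within G X \<longleftrightarrow> is_colored X \<and> Poly_Mapping.keys (pol X) \<subseteq> G"

lemma fold_expand: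
  assumes G: "\<And>m i. m \<in> G \<Longrightarrow> Poly_Mapping.keys (mu q i m) \<subseteq> G"
    and "colored_within G X" "snd ` set ps \<subseteq> Poly_Mapping.keys (pol X)"
  shows "colored_within G (fold (\<lambda>(i, m). expand q i m) ps X)
    \<and> Poly_Mapping.keys (pol X) \<subseteq> Poly_Mapping.keys (pol (fold (\<lambda>(i, m). expand q i m) ps X))"
  using assms(2,3)
proof (induction ps arbitrary: X)
  case Nil
  then show ?case by simp
next
  case (Cons x ps)
  obtain i m where x: "x = (i, m)" by force
  have m: "m \<in> Poly_Mapping.keys (pol X)" using Cons.prems x by auto
  have "colored_within G (expand q i m X)"
    using Cons.prems(1) m G[of m i] keys_expand_subset[of q i m X] is_colored_expand[OF _ m, of q i]
    by (auto simp: colored_within_def)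
  moreover have sub: "Poly_Mapping.keys (pol X) \<subseteq> Poly_Mapping.keys (pol (expand q i m X))"
    using Cons.prems(1) by (intro keys_expand_mono) (simp add: colored_within_def)
  ultimately show ?case
    using Cons.IH[of "expand q i m X"] Cons.prems(2) x by auto
qed

lemma uncolored_fold_expand:
  assumes G: "\<And>m i. m \<in> G \<Longrightarrow> Poly_Mapping.keys (mu q i m) \<subseteq> G"
    and "no_parent q G i n" "uncolored i n X" "snd ` set ps \<subseteq> G" "(i, n) \<notin> set ps"
  shows "uncolored i n (fold (\<lambda>(i, m). expand q i m) ps X)"
  using assms(3-)
proof (induction ps arbitrary: X)
  case Nil
  then show ?case by simp
next
  case (Cons x ps)
  obtain j m where x: "x = (j, m)" by force
  have "uncolored i n (expand q j m X)"
    using Cons.prems x assms(2) by (intro uncolored_expand) (auto simp: no_parent_def)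
  then show ?case
    using Cons.IH[of "expand q j m X"] Cons.prems x by auto
qed

lemma expands_at_colored_within:
  assumes G: "\<And>m i. m \<in> G \<Longrightarrow> Poly_Mapping.keys (mu q i m) \<subseteq> G"
    and "colored_within G X" "expands_at q \<kappa> X X'"
  shows "colored_within G X'" "Poly_Mapping.keys (pol X) \<subseteq> Poly_Mapping.keys (pol X')"
proof -
  obtain ps where ps: "set ps = UNIV \<times> monomials_at \<kappa> X" "X' = fold (\<lambda>(i, m). expand q i m) ps X"
    using assms(3) by (auto simp: expands_at_def)
  have "snd ` set ps \<subseteq> Poly_Mapping.keys (pol X)"
    using ps(1) by (auto simp: monomials_at_def)
  then show "colored_within G X'" "Poly_Mapping.keys (pol X) \<subseteq> Poly_Mapping.keys (pol X')"
    using fold_expand[of G q, OF G assms(2)] ps(2) by blast+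
qed

lemma expands_at_uncolored:
  assumes G: "\<And>m i. m \<in> G \<Longrightarrow> Poly_Mapping.keys (mu q i m) \<subseteq> G"
    and "colored_within G X" "expands_at q \<kappa> X X'" "no_parent q G i n" "uncolored i n X" "monomial_weight n \<noteq> \<kappa>"
  shows "uncolored i n X'"
proof -
  obtain ps where ps: "set ps = UNIV \<times> monomials_at \<kappa> X" "X' = fold (\<lambda>(i, m). expand q i m) ps X"
    using assms(3) by (auto simp: expands_at_def)
  show ?thesis unfolding ps(2)
    by (rule uncolored_fold_expand[of G q, OF G assms(4,5)])
      (use ps(1) assms(2,6) in \<open>auto simp: monomials_at_def colored_within_def\<close>)
qed

text \<open>
  The expansions at one weight are performed in an unknown order.  Those that precede \<open>(i, n)\<close>
  neither remove \<open>n\<close> nor touch its color \<open>i\<close>, and those that follow it remove nothing.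
\<close>

lemma expands_at_mu:
  assumes G: "\<And>m i. m \<in> G \<Longrightarrow> Poly_Mapping.keys (mu q i m) \<subseteq> G"
    and "colored_within G X" "expands_at q \<kappa> X X'" "no_parent q G i n" "uncolored i n X"
    and "n \<in> monomials_at \<kappa> X"
  shows "Poly_Mapping.keys (mu q i n) \<subseteq> Poly_Mapping.keys (pol X')"
proof -
  obtain ps where ps: "distinct ps" "set ps = UNIV \<times> monomials_at \<kappa> X"
    "X' = fold (\<lambda>(i, m). expand q i m) ps X"
    using assms(3) by (auto simp: expands_at_def)
  have "(i, n) \<in> set ps" using ps(2) assms(6) by auto
  then obtain as bs where split: "ps = as @ (i, n) # bs"
    by (meson split_list)
  have occ: "snd ` set ps \<subseteq> Poly_Mapping.keys (pol X)"
    using ps(2) by (auto simp: monomials_at_def)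
  \<comment> \<open>The state just before the \<open>i\<close>-expansion of \<open>n\<close>.\<close>
  define Z where "Z = fold (\<lambda>(i, m). expand q i m) as X"
  have Z: "colored_within G Z" "Poly_Mapping.keys (pol X) \<subseteq> Poly_Mapping.keys (pol Z)"
    unfolding Z_def using fold_expand[of G q, OF G assms(2), of as] occ split by auto
  have cl: "uncolored i n Z"
    unfolding Z_def
    by (rule uncolored_fold_expand[of G q, OF G assms(4,5)])
      (use occ split ps(1) assms(2) in \<open>auto simp: colored_within_def\<close>)
  have nZ: "n \<in> Poly_Mapping.keys (pol Z)" using Z(2) occ split by auto
  define W where "W = expand q i n Z"
  have "Poly_Mapping.keys (mu q i n) \<subseteq> Poly_Mapping.keys (pol W)"
    unfolding W_def using Z(1) nZ cl by (intro keys_mu_subset_expand) (auto simp: colored_within_def)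
  moreover have "Poly_Mapping.keys (pol W) \<subseteq> Poly_Mapping.keys (pol X')"
  proof -
    have "colored_within G W" "Poly_Mapping.keys (pol Z) \<subseteq> Poly_Mapping.keys (pol W)"
      using fold_expand[of G q, OF G Z(1), of "[(i, n)]"] nZ by (auto simp: W_def)
    moreover have "X' = fold (\<lambda>(i, m). expand q i m) bs W"
      by (simp add: ps(3) split W_def Z_def)
    ultimately show ?thesis
      using fold_expand[of G q, OF G, of W bs] occ split Z(2) by auto
  qed
  ultimately show ?thesis by blast
qed

text \<open>
  Monomials that occur in every run which gets far enough: \<open>n'\<close> is created by the \<open>i\<close>-expansion of
  \<open>n\<close>, and that expansion takes place because color \<open>i\<close> of \<open>n\<close> is still \<open>0\<close> at that moment.
\<close>

inductive forced :: "complex \<Rightarrow> monomial set \<Rightarrow> monomial \<Rightarrow> monomial \<Rightarrow> bool" for q G m where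
  forced_start: "forced q G m m"
| forced_mu: "forced q G m n \<Longrightarrow> no_parent q G i n \<Longrightarrow> n' \<in> Poly_Mapping.keys (mu q i n)
    \<Longrightarrow> n' \<noteq> n \<Longrightarrow> forced q G m n'"

lemma weight_le_refl: "weight_le \<nu> \<nu>"
  unfolding weight_le_def by (rule exI[of _ "\<lambda>_. 0"]) simp

lemma weight_le_trans:
  assumes "weight_le \<nu> \<kappa>" "weight_le \<kappa> \<tau>"
  shows "weight_le \<nu> \<tau>"
proof -
  obtain c d where "\<kappa> - \<nu> = (\<Sum>i\<in>UNIV. int (c i) *s \<alpha> i)" "\<tau> - \<kappa> = (\<Sum>i\<in>UNIV. int (d i) *s \<alpha> i)"
    using assms by (auto simp: weight_le_def)
  moreover have "\<tau> - \<nu> = (\<kappa> - \<nu>) + (\<tau> - \<kappa>)" by simp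
  ultimately have "\<tau> - \<nu> = (\<Sum>i\<in>UNIV. int (c i + d i) *s \<alpha> i)"
    by (simp only: of_nat_add vector_sadd_rdistrib sum.distrib)
  then show ?thesis unfolding weight_le_def by (intro exI[of _ "\<lambda>i. c i + d i"])
qed

lemma FM_enumerationD:
  assumes "FM_enumeration \<kappa> R lam"
  shows "antisym R"
    and "weight_le \<mu> \<kappa> \<Longrightarrow> weight_le \<nu> \<kappa> \<Longrightarrow> weight_le \<mu> \<nu> \<Longrightarrow> (\<mu>, \<nu>) \<in> R"
    and "weight_le \<mu> \<kappa> \<Longrightarrow> \<exists>k. lam k = \<mu>"
    and "weight_le (lam k) \<kappa>"
    and "k < l \<Longrightarrow> (lam l, lam k) \<in> R"
    and "k < l \<Longrightarrow> lam l \<noteq> lam k"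
proof -
  note en = assms[unfolded FM_enumeration_def, THEN conjunct1]
    assms[unfolded FM_enumeration_def, THEN conjunct2, THEN conjunct1]
    assms[unfolded FM_enumeration_def, THEN conjunct2, THEN conjunct2, THEN conjunct1]
    assms[unfolded FM_enumeration_def, THEN conjunct2, THEN conjunct2, THEN conjunct2, THEN conjunct2]
  show "antisym R" using en(1) by (simp add: order_on_defs)
  show "weight_le \<mu> \<kappa> \<Longrightarrow> weight_le \<nu> \<kappa> \<Longrightarrow> weight_le \<mu> \<nu> \<Longrightarrow> (\<mu>, \<nu>) \<in> R"
    using en(2) by blast
  show "\<exists>k. lam k = \<mu>" if "weight_le \<mu> \<kappa>"
  proof -
    have "\<mu> \<in> range lam" using that en(3) by simp
    then show ?thesis by auto
  qed
  have "lam k \<in> range lam" by simp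
  then show "weight_le (lam k) \<kappa>" unfolding en(3) by simp
  show "k < l \<Longrightarrow> (lam l, lam k) \<in> R" "k < l \<Longrightarrow> lam l \<noteq> lam k"
    using en(4) by blast+
qed

text \<open>
  After the stopping criterion is met, no monomial of a later weight is left to be expanded.
\<close>

lemma run_constant_after_stop:
  assumes en: "FM_enumeration \<kappa> R lam" and run: "FM_run q m lam X"
    and adm: "\<And>j. j < k \<Longrightarrow> all_admissible_at (lam j) (X j)"
    and stop: "FM_stops R (lam i) (X (Suc i))" and "i < k"
  shows "X k = X (Suc i)"
proof -
  have "X (Suc i + d) = X (Suc i)" if "Suc i + d \<le> k" for d
    using that
  proof (induction d)
    case 0
    then show ?case by simp
  next
    case (Suc d)
    define l where "l = Suc i + d"
    have l: "i < l" "l < k" "Suc i + Suc d = Suc l"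
      using Suc.prems by (simp_all add: l_def)
    have IH: "X l = X (Suc i)" using Suc l_def by simp
    have none: "monomials_at (lam l) (X l) = {}"
      using stop FM_enumerationD(5,6)[OF en l(1)]
      unfolding FM_stops_def monomials_at_def IH by auto
    have "\<forall>j\<le>l. all_admissible_at (lam j) (X j)"
      using adm l(2) by simp
    then have "expands_at q (lam l) (X l) (X (Suc l))"
      using run unfolding FM_run_def by blast
    then have "X (Suc l) = X l"
      unfolding expands_at_def none by auto
    then show ?case unfolding l(3) IH .
  qed
  from this[of "k - Suc i"] show ?thesis using \<open>i < k\<close> by simp
qed

text \<open>
  Failure also requires that the run has not stopped before.  But once it has stopped, no
  monomial of a later weight is left that could be inadmissible, so the first inadmissible stage
  is reached without a stop.
\<close>

lemma FM_run_fails_if_inadmissible: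
  assumes en: "FM_enumeration \<kappa> R lam" and run: "FM_run q m lam X"
    and "\<not> all_admissible_at (lam l) (X l)"
  shows "FM_run_fails R lam X"
proof -
  define k where "k = (LEAST k. \<not> all_admissible_at (lam k) (X k))"
  have k: "\<not> all_admissible_at (lam k) (X k)"
    unfolding k_def using assms(3) by (rule LeastI)
  have adm: "all_admissible_at (lam j) (X j)" if "j < k" for j
    using not_less_Least that unfolding k_def by blast
  have "\<not> FM_stops R (lam j) (X (Suc j))" if "j < k" for j
  proof
    assume stop: "FM_stops R (lam j) (X (Suc j))"
    have "X k = X (Suc j)"
      using run_constant_after_stop[OF en run adm stop that] .
    moreover have "(lam k, lam j) \<in> R" "lam k \<noteq> lam j"
      using FM_enumerationD(5,6)[OF en that] by simp_all
    ultimately have "monomials_at (lam k) (X k) = {}"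
      using stop by (auto simp: FM_stops_def monomials_at_def)
    with k show False by (simp add: all_admissible_at_def)
  qed
  with k adm show ?thesis
    by (auto simp: FM_run_fails_def all_admissible_at_def)
qed

text \<open>
  Suppose some run does not fail.  Then every stage is admissible and is followed by its
  expansions, so all monomials stay in \<open>G\<close>.  Colors without a parent in \<open>G\<close> are \<open>0\<close> when the
  turn of their monomial comes, whence by induction all forced monomials are present at their
  turn.  For \<open>n\<close> this contradicts admissibility.
\<close>

theorem FM_fails_criterion:
  assumes G: "\<And>m i. m \<in> G \<Longrightarrow> Poly_Mapping.keys (mu q i m) \<subseteq> G" and "m \<in> G"
    and n: "forced q G m n" and fr: "no_parent q G i n" and nd: "\<not> i_dominant i n"
  shows "FM_fails q m"
  unfolding FM_fails_def
proof (intro allI impI)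
  fix R lam X
  assume en: "FM_enumeration (monomial_weight m) R lam" and run: "FM_run q m lam X"
  show "FM_run_fails R lam X"
  proof (rule ccontr)
    assume "\<not> FM_run_fails R lam X"
    then have adm: "all_admissible_at (lam k) (X k)" for k
      using FM_run_fails_if_inadmissible[OF en run] by blast
    then have stage: "expands_at q (lam k) (X k) (X (Suc k))" for k
      using run by (simp add: FM_run_def)
    have X0: "X 0 = FM_start m" using run by (simp add: FM_run_def)
    have colored_within: "colored_within G (X k)" for k
    proof (induction k)
      case 0
      then show ?case
        using is_colored_FM_start \<open>m \<in> G\<close> by (simp add: X0 colored_within_def) (simp add: FM_start_def)
    next
      case (Suc k)
      then show ?case using expands_at_colored_within(1)[of G q, OF G _ stage] by blast
    qed
    have mono: "Poly_Mapping.keys (pol (X k)) \<subseteq> Poly_Mapping.keys (pol (X l))" if "k \<le> l" for k l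
      using that
    proof (induction l rule: dec_induct)
      case (step l')
      then show ?case
        using expands_at_colored_within(2)[of G q, OF G colored_within stage] by blast
    qed simp
    \<comment> \<open>The enumeration visits a larger weight first, by antisymmetry of the total order.\<close>
    have lam_lt: "k < l"
      if "weight_le (lam l) (lam k)" "lam l \<noteq> lam k" for k l
    proof (rule ccontr)
      assume "\<not> k < l"
      then have "l < k" using that(2) by (metis linorder_less_linear)
      then have "(lam k, lam l) \<in> R" by (rule FM_enumerationD(5)[OF en])
      moreover have "(lam l, lam k) \<in> R"
        using FM_enumerationD(2)[OF en FM_enumerationD(4)[OF en] FM_enumerationD(4)[OF en] that(1)] .
      ultimately show False using that(2) FM_enumerationD(1)[OF en] by (metis antisymD)
    qed
    have uncolored: "uncolored j w (X k)" if "no_parent q G j w" "lam k = monomial_weight w" for j w k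
    proof -
      have "l \<le> k \<Longrightarrow> uncolored j w (X l)" for l
      proof (induction l)
        case 0
        then show ?case by (simp add: X0 uncolored_def FM_start_def)
      next
        case (Suc l)
        have "lam k \<noteq> lam l" using FM_enumerationD(6)[OF en, of l k] Suc.prems by simp
        then have "monomial_weight w \<noteq> lam l" unfolding that(2) .
        moreover have "uncolored j w (X l)" using Suc by simp
        ultimately show ?case
          by (intro expands_at_uncolored[of G q, OF G colored_within stage that(1)])
      qed
      then show ?thesis by simp
    qed
    have "weight_le (monomial_weight w) (monomial_weight m) \<and>
        (\<forall>k. lam k = monomial_weight w \<longrightarrow> w \<in> Poly_Mapping.keys (pol (X k)))"
      if "forced q G m w" for w
      using that
    proof induction
      case forced_start
      have "m \<in> Poly_Mapping.keys (pol (X 0))" by (simp add: X0 FM_start_def)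
      then have "m \<in> Poly_Mapping.keys (pol (X k))" for k using mono[of 0 k] by auto
      then show ?case using weight_le_refl by simp
    next
      case (forced_mu w j w')
      then have le: "weight_le (monomial_weight w') (monomial_weight m)"
        using weight_less_keys_mu(1)[OF forced_mu.hyps(3,4)] forced_mu.IH weight_le_trans by blast
      obtain k where k: "lam k = monomial_weight w"
        using FM_enumerationD(3)[OF en] forced_mu.IH by blast
      then have "w \<in> monomials_at (lam k) (X k)"
        using forced_mu.IH by (simp add: monomials_at_def)
      then have *: "w' \<in> Poly_Mapping.keys (pol (X (Suc k)))"
        using expands_at_mu[of G q, OF G colored_within stage forced_mu.hyps(2) uncolored[OF forced_mu.hyps(2) k]]
          forced_mu.hyps(3) by blast
      have "w' \<in> Poly_Mapping.keys (pol (X l))" if "lam l = monomial_weight w'" for l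
      proof -
        have "k < l" using lam_lt[of l k] that k weight_less_keys_mu[OF forced_mu.hyps(3,4)] by simp
        then show ?thesis using * mono[of "Suc k" l] by auto
      qed
      with le show ?case by blast
    qed
    note occurs = this[OF n]
    obtain k where k: "lam k = monomial_weight n"
      using FM_enumerationD(3)[OF en] occurs by blast
    have occ: "n \<in> Poly_Mapping.keys (pol (X k))" using occurs k by blast
    then have "admissible (X k) n"
      using adm[of k] k by (simp add: all_admissible_at_def monomials_at_def)
    moreover have "col (X k) n i = 0"
      using uncolored[OF fr k] occ by (simp add: uncolored_def)
    moreover have "Poly_Mapping.lookup (pol (X k)) n > 0"
    proof -
      have "0 \<le> Poly_Mapping.lookup (pol (X k)) n"
        using colored_within[of k] occ by (force simp: colored_within_def is_colored_def)
      then show ?thesis using occ by (simp add: in_keys_iff)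
    qed
    ultimately show False using nd by (simp add: admissible_def)
  qed
qed

section \<open>Products without cancellation\<close>

text \<open>
  A monomial that is picked in each factor of a product survives in the product if no coefficient
  is negative.
\<close>

definition nonneg :: "('a \<Rightarrow>\<^sub>0 int) \<Rightarrow> bool" where
  "nonneg f \<longleftrightarrow> (\<forall>x. 0 \<le> Poly_Mapping.lookup f x)"

lemma nonneg_add: "nonneg f \<Longrightarrow> nonneg g \<Longrightarrow> nonneg (f + g)"
  by (simp add: nonneg_def lookup_add)

lemma nonneg_single: "0 \<le> c \<Longrightarrow> nonneg (Poly_Mapping.single x c)"
  by (simp add: nonneg_def lookup_single when_def)

lemma nonneg_one: "nonneg 1"
  by (simp add: nonneg_def lookup_one when_def)

lemma nonneg_mult: "nonneg f \<Longrightarrow> nonneg g \<Longrightarrow> nonneg (f * g)"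
  unfolding nonneg_def lookup_mult Sum_any.expand_set
  by (auto intro!: sum_nonneg mult_nonneg_nonneg simp: when_def)

lemmas nonneg_intros = nonneg_add nonneg_mult nonneg_single nonneg_one

lemma keys_add_nonneg:
  "nonneg f \<Longrightarrow> nonneg g \<Longrightarrow> Poly_Mapping.keys f \<union> Poly_Mapping.keys g \<subseteq> Poly_Mapping.keys (f + g)"
  by (auto simp: nonneg_def in_keys_iff lookup_add add_nonneg_eq_0_iff)

lemma keys_mult_nonneg:
  assumes f: "nonneg f" and g: "nonneg g"
    and x: "x \<in> Poly_Mapping.keys f" and y: "y \<in> Poly_Mapping.keys g"
  shows "x + y \<in> Poly_Mapping.keys (f * g)"
proof -
  have split: "\<exists>c h'. h = Poly_Mapping.single z c + h' \<and> 0 < c \<and> nonneg h'"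
    if "nonneg h" "z \<in> Poly_Mapping.keys h" for h :: "'a \<Rightarrow>\<^sub>0 int" and z
  proof (intro exI conjI)
    show "h = Poly_Mapping.single z (Poly_Mapping.lookup h z)
        + (h - Poly_Mapping.single z (Poly_Mapping.lookup h z))"
      by simp
    have "0 \<le> Poly_Mapping.lookup h z" using that(1) by (simp add: nonneg_def)
    then show "0 < Poly_Mapping.lookup h z" using that(2) by (simp add: in_keys_iff)
    show "nonneg (h - Poly_Mapping.single z (Poly_Mapping.lookup h z))"
      using that(1) by (auto simp: nonneg_def lookup_minus lookup_single when_def)
  qed
  obtain c f' where f': "f = Poly_Mapping.single x c + f'" "0 < c" "nonneg f'"
    using split[OF f x] by blast
  obtain d g' where g': "g = Poly_Mapping.single y d + g'" "0 < d" "nonneg g'"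
    using split[OF g y] by blast
  have eq: "f * g = Poly_Mapping.single (x + y) (c * d) + (Poly_Mapping.single x c * g' + f' * g)"
    unfolding f'(1) g'(1) by (simp add: distrib_left distrib_right mult_single add.assoc)
  have "nonneg (Poly_Mapping.single x c * g' + f' * g)"
    using f'(2,3) g'(3) g by (intro nonneg_intros) simp_all
  moreover have "nonneg (Poly_Mapping.single (x + y) (c * d))"
    using f'(2) g'(2) by (intro nonneg_single) simp
  moreover have "x + y \<in> Poly_Mapping.keys (Poly_Mapping.single (x + y) (c * d))"
    using f'(2) g'(2) by simp
  ultimately show ?thesis unfolding eq using keys_add_nonneg by blast
qed

section \<open>The monomials on the way to failure\<close>

lemma subset_mset_pair:
  assumes "W \<subseteq># {#a, b#}"
  shows "W = {#} \<or> W = {#a#} \<or> W = {#b#} \<or> W = {#a, b#}"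
proof -
  have single: "V = {#} \<or> V = {#c#}" if "V \<subseteq># {#c#}" for V and c :: 'a
    using that by (cases V) (auto simp: insert_subset_eq_iff)
  show ?thesis
  proof (cases "a \<in># W")
    case True
    then obtain V where V: "W = add_mset a V" by (metis mset_add)
    with assms have "V \<subseteq># {#b#}" by simp
    then show ?thesis using single[of V b] V by auto
  next
    case False
    have "W \<subseteq># {#b#}"
    proof (rule mset_subset_eqI)
      fix c
      show "count W c \<le> count {#b#} c"
        using mset_subset_eq_count[OF assms, of c] False by (cases "c = a") (auto simp: not_in_iff)
    qed
    then show ?thesis using single[of W b] by auto
  qed
qed

definition m_plus :: "complex \<Rightarrow> monomial" where
  "m_plus q = Y N1 (q ^ 4) + Y N2 q + Y N3 (q powi (- 2))"

definition below :: "complex \<Rightarrow> (node \<times> complex) multiset \<Rightarrow> monomial" where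
  "below q U = m_plus q - A_product q U"

lemma below_add_mset: "below q (add_mset (i, a) U) = below q U - A q i a"
  by (simp add: below_def algebra_simps)

text \<open>
  The contents in which \<open>A\<^bsub>1,q^3\<^esub>\<close> has been removed although \<open>A\<^bsub>2,q^2\<^esub>\<close> has been removed at most
  once, restricted to divisors of the content of the last monomial of the chain.
\<close>

definition forbidden :: "complex \<Rightarrow> (node \<times> complex) multiset set" where
  "forbidden q = {add_mset (N1, q ^ 3) W | W. W \<subseteq># {#(N3, 1), (N2, q ^ 2)#}}"

definition avoiding :: "complex \<Rightarrow> monomial set" where
  "avoiding q = {below q U | U. U \<notin> forbidden q}"

context
  fixes q :: complex
  assumes q: "q \<noteq> 0" "\<forall>n::nat. 0 < n \<longrightarrow> q ^ n \<noteq> 1"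
begin

lemma below_inject: "below q U = below q V \<longleftrightarrow> U = V"
  using A_product_inject[OF q] by (auto simp: below_def)

lemma below_keys_mu:
  assumes "n \<in> Poly_Mapping.keys (mu q i (below q U))"
  obtains S where "n = below q (U + image_mset (Pair i) S)"
  using assms by (elim keys_mu) (simp add: below_def algebra_simps)

text \<open>
  For the contents \<open>W\<close> here, the \<open>1\<close>-part of the monomial is \<open>Y\<^bsub>q^4\<^esub>\<close> or \<open>Y\<^bsub>q^2\<^esub> Y\<^bsub>q^4\<^esub>\<close>, in either case a
  single string with top \<open>q^4\<close>.  A string is emptied from the top, starting with \<open>A\<^bsub>1,q^5\<^esub>\<close>.
\<close>

lemma A1_not_first:
  assumes W: "W \<subseteq># {#(N3, 1), (N2, q ^ 2)#}"
  shows "below q (add_mset (N1, q ^ 3) W) \<notin> Poly_Mapping.keys (mu q N1 (below q W))"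
proof -
  have diff: "q ^ 3 \<noteq> q ^ 5"
  proof
    assume "q ^ 3 = q ^ 5"
    have "q ^ 3 * q ^ 2 = q ^ 5" by (simp flip: power_add)
    with \<open>q ^ 3 = q ^ 5\<close> have "q ^ 3 * q ^ 2 = q ^ 3" by metis
    then have "q ^ 2 = 1" using q(1) by (metis mult_cancel_left2 power_eq_0_iff)
    then show False using q(2) by simp
  qed
  let ?n = "below q (add_mset (N1, q ^ 3) W)"
  have "add_mset (N1, q ^ 3) W \<noteq> W" "add_mset (N1, q ^ 3) W \<noteq> add_mset (N1, q ^ 3) (add_mset (N1, q ^ 5) W)"
    by (auto dest: arg_cong[where f = size])
  moreover have "count (add_mset (N1, q ^ 3) W) (N1, q ^ 3) \<noteq> count (add_mset (N1, q ^ 5) W) (N1, q ^ 3)"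
    using diff by simp
  then have "add_mset (N1, q ^ 3) W \<noteq> add_mset (N1, q ^ 5) W" by metis
  ultimately have ne: "?n \<noteq> below q W" "?n \<noteq> below q (add_mset (N1, q ^ 5) W)"
    "?n \<noteq> below q (add_mset (N1, q ^ 3) (add_mset (N1, q ^ 5) W))"
    unfolding below_inject by blast+
  have "(bar N1 (below q W) = Poly_Mapping.single (q ^ 4) 1) \<or>
     (bar N1 (below q W) = Poly_Mapping.single (q ^ 2) 1 + Poly_Mapping.single (q ^ 4) 1)"
    using subset_mset_pair[OF W] by (auto simp: below_def m_plus_def bar_simps)
  then show ?thesis
  proof
    assume "bar N1 (below q W) = Poly_Mapping.single (q ^ 4) 1"
    then have "mu q N1 (below q W) = Poly_Mapping.single (below q W) 1
        * (1 + Poly_Mapping.single (- A q N1 (q ^ 5)) 1)"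
      using mu_pair[of q q N1 "q ^ 4" "below q W" 1 0] q by (simp flip: power_Suc2)
    then have "mu q N1 (below q W) = Poly_Mapping.single (below q W) 1
        + Poly_Mapping.single (below q (add_mset (N1, q ^ 5) W)) 1"
      by (simp add: distrib_left mult_single below_add_mset del: A.simps)
    then show ?thesis using ne
      by (simp add: in_keys_iff lookup_add lookup_single when_def)
  next
    assume "bar N1 (below q W) = Poly_Mapping.single (q ^ 2) 1 + Poly_Mapping.single (q ^ 4) 1"
    then have "mu q N1 (below q W) = Poly_Mapping.single (below q W) 1
        * (1 + Poly_Mapping.single (- A q N1 (q ^ 5)) 1
             + Poly_Mapping.single (- A q N1 (q ^ 5) - A q N1 (q ^ 3)) 1)"
      using mu_pair[of q q N1 "q ^ 2" "below q W" 1 1] q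
      by (simp flip: power_Suc2 power_add)
    then have "mu q N1 (below q W) = Poly_Mapping.single (below q W) 1
        + Poly_Mapping.single (below q (add_mset (N1, q ^ 5) W)) 1
        + Poly_Mapping.single (below q (add_mset (N1, q ^ 3) (add_mset (N1, q ^ 5) W))) 1"
      by (simp add: distrib_left mult_single below_add_mset diff_diff_add algebra_simps
          del: A.simps)
    then show ?thesis using ne
      by (simp add: in_keys_iff lookup_add lookup_single when_def)
  qed
qed

text \<open>
  Suppose an \<open>i\<close>-expansion leads from a content \<open>U\<close> that is not forbidden to a forbidden one.  If
  \<open>A\<^bsub>1,q^3\<^esub>\<close> belongs to \<open>U\<close>, then \<open>U\<close> is forbidden itself, since forbidden contents are closed
  under removing other factors.  Otherwise \<open>i = 1\<close> and the expansion removes \<open>A\<^bsub>1,q^3\<^esub>\<close> and nothing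
  else, which \<open>A1_not_first\<close> excludes.
\<close>

lemma avoiding_closed:
  assumes "m \<in> avoiding q"
  shows "Poly_Mapping.keys (mu q i m) \<subseteq> avoiding q"
proof
  fix n assume n: "n \<in> Poly_Mapping.keys (mu q i m)"
  obtain U where U: "m = below q U" "U \<notin> forbidden q"
    using assms by (auto simp: avoiding_def)
  obtain S where S: "n = below q (U + image_mset (Pair i) S)"
    using below_keys_mu n U(1) by metis
  have "U + image_mset (Pair i) S \<notin> forbidden q"
  proof
    assume "U + image_mset (Pair i) S \<in> forbidden q"
    then obtain W where W: "W \<subseteq># {#(N3, 1), (N2, q ^ 2)#}"
      and eq: "U + image_mset (Pair i) S = add_mset (N1, q ^ 3) W"
      by (auto simp: forbidden_def)
    show False
    proof (cases "(N1, q ^ 3) \<in># U")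
      case True
      then obtain V where V: "U = add_mset (N1, q ^ 3) V" by (metis mset_add)
      then have "V \<subseteq># W" using eq by auto
      then show False using U(2) V W subset_mset.order_trans by (auto simp: forbidden_def)
    next
      case False
      then have mem: "(N1, q ^ 3) \<in># image_mset (Pair i) S"
        using eq by (metis union_iff union_single_eq_member)
      then have i: "i = N1" and "q ^ 3 \<in># S" by auto
      then obtain T where T: "S = add_mset (q ^ 3) T" by (metis mset_add)
      then have sum: "U + image_mset (Pair N1) T = W" using eq i by simp
      have "T = {#}"
      proof (rule ccontr)
        assume "T \<noteq> {#}"
        then obtain a where "a \<in># T" by auto
        then have "(N1, a) \<in># W" using sum by auto
        then show False using mset_subset_eqD[OF W] by auto
      qed
      then have "U = W" "n = below q (add_mset (N1, q ^ 3) W)" using sum S eq by auto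
      then show False using A1_not_first[OF W] n U(1) i by simp
    qed
  qed
  then show "n \<in> avoiding q" using S by (auto simp: avoiding_def)
qed

text \<open>
  An \<open>i\<close>-expansion that reaches another monomial leaves a factor \<open>A\<^bsub>i,a\<^esub>\<close> in its content.
\<close>

lemma no_parent_if_no_A:
  assumes "\<And>a. (i, a) \<notin># V"
  shows "no_parent q (avoiding q) i (below q V)"
  unfolding no_parent_def
proof (intro ballI impI)
  fix m assume "m \<in> avoiding q" and key: "below q V \<in> Poly_Mapping.keys (mu q i m)"
  then obtain U where U: "m = below q U" by (auto simp: avoiding_def)
  obtain S where "below q V = below q (U + image_mset (Pair i) S)"
    using below_keys_mu key U by metis
  then have V: "V = U + image_mset (Pair i) S" by (simp add: below_inject)
  have "S = {#}"
  proof (rule ccontr)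
    assume "S \<noteq> {#}"
    then obtain a where "a \<in># S" by auto
    then show False using assms[of a] V by auto
  qed
  then show "m = below q V" using U V by simp
qed

text \<open>
  A parent in direction \<open>2\<close> would have lost \<open>A\<^bsub>1,q^3\<^esub>\<close> and at most one \<open>A\<^bsub>2,q^2\<^esub>\<close>, so its
  content would be forbidden.
\<close>

lemma no_parent_last:
  "no_parent q (avoiding q) N2 (below q {#(N1, q ^ 3), (N2, q ^ 2), (N2, q ^ 2), (N3, 1)#})"
    (is "no_parent q _ _ (below q ?V)")
  unfolding no_parent_def
proof (intro ballI impI)
  fix m assume m: "m \<in> avoiding q" and key: "below q ?V \<in> Poly_Mapping.keys (mu q N2 m)"
  then obtain U where U: "m = below q U" "U \<notin> forbidden q" by (auto simp: avoiding_def)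
  obtain S where "below q ?V = below q (U + image_mset (Pair N2) S)"
    using below_keys_mu key U by metis
  then have V: "U + image_mset (Pair N2) S = ?V" by (simp add: below_inject)
  have "S = {#}"
  proof (rule ccontr)
    assume "S \<noteq> {#}"
    then obtain a where "a \<in># S" by auto
    then have "(N2, a) \<in># ?V" unfolding V[symmetric] by auto
    then have "a = q ^ 2" by auto
    then obtain T where T: "S = add_mset (q ^ 2) T" using \<open>a \<in># S\<close> by (metis mset_add)
    have "(N1, q ^ 3) \<in># U + image_mset (Pair N2) S" unfolding V by simp
    then have "(N1, q ^ 3) \<in># U" by auto
    then obtain W where W: "U = add_mset (N1, q ^ 3) W" by (metis mset_add)
    have "W + image_mset (Pair N2) T = {#(N3, 1), (N2, q ^ 2)#}"
      using V unfolding W T by (simp add: add_mset_commute)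
    then have "W \<subseteq># {#(N3, 1), (N2, q ^ 2)#}" by (metis mset_subset_eq_add_left)
    then show False using U(2) W by (auto simp: forbidden_def)
  qed
  then show "m = below q ?V" using U V by simp
qed

text \<open>
  The \<open>3\<close>-part of the monomial is the single point \<open>q^(-2)\<close>, and \<open>q_3 = q^2\<close>, so the
  factor taken is \<open>A\<^bsub>3,1\<^esub>\<close>.
\<close>

lemma key_A3: "below q {#(N3, 1)#} \<in> Poly_Mapping.keys (mu q N3 (below q {#}))"
proof -
  have p: "q ^ 2 \<noteq> 0" "\<forall>n::nat. 0 < n \<longrightarrow> (q ^ 2) ^ n \<noteq> 1"
    using q by (simp_all flip: power_mult)
  have "bar N3 (below q {#}) = Poly_Mapping.single (q powi (- 2)) 1"
    by (simp add: below_def m_plus_def bar_simps)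
  then have "mu q N3 (below q {#}) = Poly_Mapping.single (below q {#}) 1
      * (1 + Poly_Mapping.single (- A q N3 (q powi (- 2) * q ^ 2)) 1)"
    using mu_pair[of "q ^ 2" q N3 "q powi (- 2)" "below q {#}" 1 0] p q(1) by simp
  moreover have "q powi (- 2) * q ^ 2 = 1" using q(1) by (simp add: power_int_minus)
  ultimately have "mu q N3 (below q {#}) = Poly_Mapping.single (below q {#}) 1
      + Poly_Mapping.single (below q {#(N3, 1)#}) 1"
    by (simp add: distrib_left mult_single below_def del: A.simps)
  then show ?thesis by (auto simp: in_keys_iff lookup_add lookup_single when_def)
qed

text \<open>
  The \<open>2\<close>-part is \<open>Y\<^bsub>1/q\<^esub> Y\<^bsub>q\<^esub>^2\<close>, with strings \<open>{q}\<close> and \<open>{1/q, q}\<close>.  Both have top \<open>q\<close>, so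
  \<open>A\<^bsub>2,q^2\<^esub>\<close> can be taken from each of them.
\<close>

lemma key_A2: "below q {#(N2, q ^ 2), (N2, q ^ 2), (N3, 1)#}
  \<in> Poly_Mapping.keys (mu q N2 (below q {#(N3, 1)#}))"
proof -
  have s2: "Poly_Mapping.single q (2::int) = Poly_Mapping.single q 1 + Poly_Mapping.single q 1"
    by (simp flip: single_add)
  have "bar N2 (below q {#(N3, 1)#}) = Poly_Mapping.single (1 / q) (int 1)
      + Poly_Mapping.single (1 / q * q ^ 2) (int 2)"
    using q(1) by (simp add: below_def m_plus_def bar_simps power2_eq_square s2)
  from mu_pair[OF _ _ _ _ this] have "mu q N2 (below q {#(N3, 1)#}) =
      Poly_Mapping.single (below q {#(N3, 1)#}) 1
      * (1 + Poly_Mapping.single (- A q N2 (q ^ 2)) 1)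
      * (1 + Poly_Mapping.single (- A q N2 (q ^ 2)) 1
           + Poly_Mapping.single (- A q N2 (q ^ 2) - A q N2 1) 1)"
    using q by (simp add: power2_eq_square power3_eq_cube del: A.simps)
  moreover have "- A q N2 (q ^ 2) \<in> Poly_Mapping.keys (1 + Poly_Mapping.single (- A q N2 (q ^ 2)) (1::int))"
    "- A q N2 (q ^ 2) \<in> Poly_Mapping.keys (1 + Poly_Mapping.single (- A q N2 (q ^ 2)) (1::int)
           + Poly_Mapping.single (- A q N2 (q ^ 2) - A q N2 1) 1)"
    by (simp_all add: in_keys_iff lookup_add lookup_one lookup_single when_def del: A.simps)
  ultimately have "below q {#(N3, 1)#} + - A q N2 (q ^ 2) + - A q N2 (q ^ 2)
      \<in> Poly_Mapping.keys (mu q N2 (below q {#(N3, 1)#}))"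
    by (auto intro!: keys_mult_nonneg nonneg_intros simp del: A.simps add_uminus_conv_diff)
  then show ?thesis by (simp add: below_add_mset del: A.simps)
qed

text \<open>
  The \<open>1\<close>-part is \<open>Y\<^bsub>q^2\<^esub>^2 Y\<^bsub>q^4\<^esub>\<close>, with strings \<open>{q^2}\<close> and \<open>{q^2, q^4}\<close>; the factor
  \<open>A\<^bsub>1,q^3\<^esub>\<close> is taken from the first and nothing from the second.
\<close>

lemma key_A1: "below q {#(N1, q ^ 3), (N2, q ^ 2), (N2, q ^ 2), (N3, 1)#}
  \<in> Poly_Mapping.keys (mu q N1 (below q {#(N2, q ^ 2), (N2, q ^ 2), (N3, 1)#}))"
    (is "_ \<in> Poly_Mapping.keys (mu q N1 ?m)")
proof -
  have s2: "Poly_Mapping.single (q ^ 2) (2::int)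
      = Poly_Mapping.single (q ^ 2) 1 + Poly_Mapping.single (q ^ 2) 1"
    by (simp flip: single_add)
  have "bar N1 ?m = Poly_Mapping.single (q ^ 2) (int 2)
      + Poly_Mapping.single (q ^ 2 * q ^ 2) (int 1)"
    by (simp add: below_def m_plus_def bar_simps s2 flip: power_add)
  from mu_pair[OF _ _ _ _ this] have "mu q N1 ?m =
      Poly_Mapping.single ?m 1
      * (1 + Poly_Mapping.single (- A q N1 (q ^ 3)) 1)
      * (1 + Poly_Mapping.single (- A q N1 (q ^ 5)) 1
           + Poly_Mapping.single (- A q N1 (q ^ 5) - A q N1 (q ^ 3)) 1)"
    using q by (simp del: A.simps flip: power_add power_Suc2)
  moreover have "- A q N1 (q ^ 3) \<in> Poly_Mapping.keys (1 + Poly_Mapping.single (- A q N1 (q ^ 3)) (1::int))"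
    "0 \<in> Poly_Mapping.keys (1 + Poly_Mapping.single (- A q N1 (q ^ 5)) (1::int)
           + Poly_Mapping.single (- A q N1 (q ^ 5) - A q N1 (q ^ 3)) 1)"
    by (simp_all add: in_keys_iff lookup_add lookup_one lookup_single when_def del: A.simps)
  ultimately have "?m + - A q N1 (q ^ 3) + 0 \<in> Poly_Mapping.keys (mu q N1 ?m)"
    by (auto intro!: keys_mult_nonneg nonneg_intros simp del: A.simps add_uminus_conv_diff add_0_right)
  then show ?thesis by (simp add: below_add_mset del: A.simps)
qed

lemma last_not_2_dominant:
  "\<not> i_dominant N2 (below q {#(N1, q ^ 3), (N2, q ^ 2), (N2, q ^ 2), (N3, 1)#})"
    (is "\<not> i_dominant N2 ?m")
proof -
  have "bar N2 ?m = Poly_Mapping.single (1 / q) 1 - Poly_Mapping.single (q ^ 3) 1"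
    using q(1) by (simp add: below_def m_plus_def bar_simps power2_eq_square power3_eq_cube)
  moreover have "1 / q \<noteq> q ^ 3"
  proof
    assume "1 / q = q ^ 3"
    then have "q ^ 4 = 1" using q(1) by (simp add: field_simps power_numeral_reduce)
    then show False using q(2) by simp
  qed
  ultimately have "Poly_Mapping.lookup ?m (N2, q ^ 3) = - 1"
    by (simp flip: lookup_bar add: lookup_minus lookup_single)
  then show ?thesis unfolding i_dominant_def by (metis neg_0_le_iff_le not_one_le_zero)
qed

lemma forced_last:
  "forced q (avoiding q) (below q {#}) (below q {#(N1, q ^ 3), (N2, q ^ 2), (N2, q ^ 2), (N3, 1)#})"
proof -
  have "forced q (avoiding q) (below q {#}) (below q {#(N3, 1)#})"
    by (rule forced_mu[OF forced_start _ key_A3]) (auto intro!: no_parent_if_no_A simp: below_inject)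
  then have "forced q (avoiding q) (below q {#}) (below q {#(N2, q ^ 2), (N2, q ^ 2), (N3, 1)#})"
    by (rule forced_mu[OF _ _ key_A2]) (auto intro!: no_parent_if_no_A simp: below_inject)
  then show ?thesis
    by (rule forced_mu[OF _ _ key_A1]) (auto intro!: no_parent_if_no_A simp: below_inject)
qed

end

theorem theorem4p1:
  fixes q :: complex
  assumes "q \<noteq> 0" and "\<forall>n::nat. 0 < n \<longrightarrow> q ^ n \<noteq> 1"
  shows "FM_fails q (Y N1 (q ^ 4) + Y N2 q + Y N3 (q powi (- 2)))"
proof -
  have "{#} \<notin> forbidden q" by (simp add: forbidden_def)
  then have "below q {#} \<in> avoiding q" by (auto simp: avoiding_def)
  then have "FM_fails q (below q {#})"
    using avoiding_closed[OF assms] forced_last[OF assms] no_parent_last[OF assms]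
      last_not_2_dominant[OF assms]
    by (intro FM_fails_criterion[of "avoiding q"])
  then show ?thesis by (simp add: below_def m_plus_def)
qed

end
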